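(* Let $G$ and $G'$ be finite groups. There exists a $(G,G')$-transformation matrix if and only if the multisets of degrees of the (complex) irreducible representations of $G$ and $G'$ are the same.
   Context: A matrix $U\in\mathbb{C}^{G\times G'}$ (rows indexed by $G$, columns by $G'$) is a $(G,G')$-transformation matrix if (1) $U$ is unitary (in particular square, so $|G|=|G'|$); (2) $\overline{U_{a,b}}=U_{a^{-1},b^{-1}}$ for all $a\in G$, $b\in G'$; and (3) $U_{ab,c}=\sum_{x,y\in G',\,xy=c}U_{a,x}U_{b,y}$ for all $a,b\in G$, $c\in G'$. The multiset of degrees of irreducible representations of a group contains the degree of one representative for each equivalence class of irreducible complex representations. *)

theory Defs
  imports
    "HOL-Algebra.Group"
    "HOL-Library.Multiset"
    "Jordan_Normal_Form.VS_Connect"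
begin

section \<open>Transformation matrices\<close>

text \<open>A matrix with rows indexed by \<open>A\<close> and columns indexed by \<open>B\<close> is a two-argument function, of
  which only the values on \<open>A \<times> B\<close> matter. As the index sets may differ, both \<open>U U* = I\<close> and
  \<open>U* U = I\<close> are required; together they force \<open>card A = card B\<close> for finite \<open>A\<close>, \<open>B\<close>.\<close>

definition unitary_on :: "'a set \<Rightarrow> 'b set \<Rightarrow> ('a \<Rightarrow> 'b \<Rightarrow> complex) \<Rightarrow> bool" where
  "unitary_on A B U \<longleftrightarrow>
     (\<forall>a\<in>A. \<forall>a'\<in>A. (\<Sum>b\<in>B. U a b * cnj (U a' b)) = (if a = a' then 1 else 0)) \<and>
     (\<forall>b\<in>B. \<forall>b'\<in>B. (\<Sum>a\<in>A. cnj (U a b) * U a b') = (if b = b' then 1 else 0))"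

definition transformation_matrix ::
    "('a, 'm) monoid_scheme \<Rightarrow> ('b, 'n) monoid_scheme \<Rightarrow> ('a \<Rightarrow> 'b \<Rightarrow> complex) \<Rightarrow> bool" where
  "transformation_matrix G G' U \<longleftrightarrow>
     unitary_on (carrier G) (carrier G') U \<and>
     (\<forall>a\<in>carrier G. \<forall>b\<in>carrier G'. cnj (U a b) = U (inv\<^bsub>G\<^esub> a) (inv\<^bsub>G'\<^esub> b)) \<and>
     (\<forall>a\<in>carrier G. \<forall>b\<in>carrier G. \<forall>c\<in>carrier G'.
        U (a \<otimes>\<^bsub>G\<^esub> b) c =
          (\<Sum>(x, y) | x \<in> carrier G' \<and> y \<in> carrier G' \<and> x \<otimes>\<^bsub>G'\<^esub> y = c. U a x * U b y))"

section \<open>Irreducible complex representations\<close>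

definition GL :: "nat \<Rightarrow> complex mat monoid" where
  "GL n = units_of (ring_mat TYPE(complex) n ())"

definition representation ::
    "('a, 'm) monoid_scheme \<Rightarrow> nat \<Rightarrow> ('a \<Rightarrow> complex mat) \<Rightarrow> bool" where
  "representation G n \<rho> \<longleftrightarrow> \<rho> \<in> hom G (GL n)"

definition invariant_subspace ::
    "('a, 'm) monoid_scheme \<Rightarrow> nat \<Rightarrow> ('a \<Rightarrow> complex mat) \<Rightarrow> complex vec set \<Rightarrow> bool" where
  "invariant_subspace G n \<rho> W \<longleftrightarrow>
     VectorSpace.subspace class_ring W (module_vec TYPE(complex) n) \<and>
     (\<forall>g\<in>carrier G. \<forall>w\<in>W. \<rho> g *\<^sub>v w \<in> W)"

definition irreducible_representation ::
    "('a, 'm) monoid_scheme \<Rightarrow> nat \<Rightarrow> ('a \<Rightarrow> complex mat) \<Rightarrow> bool" where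
  "irreducible_representation G n \<rho> \<longleftrightarrow>
     representation G n \<rho> \<and> n > 0 \<and>
     (\<forall>W. invariant_subspace G n \<rho> W \<longrightarrow> W = {0\<^sub>v n} \<or> W = carrier_vec n)"

definition equivalent_representations ::
    "('a, 'm) monoid_scheme \<Rightarrow> ('a \<Rightarrow> complex mat) \<Rightarrow> ('a \<Rightarrow> complex mat) \<Rightarrow> bool" where
  "equivalent_representations G \<rho> \<sigma> \<longleftrightarrow>
     (\<exists>n. representation G n \<rho> \<and> representation G n \<sigma> \<and>
       (\<exists>P\<in>carrier (GL n). \<forall>g\<in>carrier G. P * \<rho> g = \<sigma> g * P))"

text \<open>Extensionality makes a representation determined by its values on the group.\<close>

definition irreps :: "('a, 'm) monoid_scheme \<Rightarrow> ('a \<Rightarrow> complex mat) set" where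
  "irreps G = {\<rho> \<in> extensional (carrier G). \<exists>n. irreducible_representation G n \<rho>}"

definition irrep_classes :: "('a, 'm) monoid_scheme \<Rightarrow> ('a \<Rightarrow> complex mat) set set" where
  "irrep_classes G =
     irreps G // {(\<rho>, \<sigma>). \<rho> \<in> irreps G \<and> \<sigma> \<in> irreps G \<and> equivalent_representations G \<rho> \<sigma>}"

text \<open>The number \<open>n\<close> with \<open>\<rho> : G \<rightarrow> GL n\<close>, read off as the size of the matrix \<open>\<rho>(1)\<close>.\<close>

definition rep_degree :: "('a, 'm) monoid_scheme \<Rightarrow> ('a \<Rightarrow> complex mat) \<Rightarrow> nat" where
  "rep_degree G \<rho> = dim_row (\<rho> \<one>\<^bsub>G\<^esub>)"

text \<open>The choice of representative is immaterial, since equivalent representations have the same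
  degree. A finite group has only finitely many classes, so the convention that \<open>mset_set\<close> of an
  infinite set is empty plays no role for finite \<open>G\<close>.\<close>

definition irrep_degrees :: "('a, 'm) monoid_scheme \<Rightarrow> nat multiset" where
  "irrep_degrees G =
     image_mset (\<lambda>C. rep_degree G (SOME \<rho>. \<rho> \<in> C)) (mset_set (irrep_classes G))"

end

theory Submission
  imports Defs "Jordan_Normal_Form.Spectral_Radius" "HOL-Combinatorics.Permutations"
begin

text \<open>A transformation matrix is a unitary \<open>*\<close>-isomorphism \<open>\<phi>\<close> of the group algebras. Composition with
  \<open>\<phi>\<close> turns representations of \<open>G'\<close> into representations of \<open>G\<close> of the same degree; it preserves
  invariant subspaces and intertwiners, and the adjoint matrix undoes it, so it is a degree-preserving
  bijection between the classes of irreducible representations.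

  Conversely, represent each class by a unitary representation and match the classes \<open>\<rho>\<^sub>i\<close> of \<open>G\<close> with
  the classes \<open>\<sigma>\<^sub>i\<close> of \<open>G'\<close> along equal degrees \<open>d\<^sub>i\<close>. The Fourier transform of \<open>G\<close> followed by the
  inverse one of \<open>G'\<close> is the matrix with entries \<open>1/|G'| \<Sum>\<^sub>i d\<^sub>i tr (\<rho>\<^sub>i a \<cdot> \<sigma>\<^sub>i x\<^sup>-\<^sup>1)\<close>. It is a
  transformation matrix by Schur orthogonality and by completeness: a function on the group that is
  annihilated by all irreducible unitary representations vanishes, since it is then annihilated by the
  regular representation. Completeness also gives the unitary representatives, because an irreducible
  representation inequivalent to all unitary ones would have vanishing coefficients.\<close>

text \<open>Unitary representatives are used because conjugating their coefficients inverts the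
  argument and transposes the indices; this yields the condition on \<open>cnj (U a b)\<close>. The
  weights \<open>d\<^sub>i / |G'|\<close> cancel the constants of Schur orthogonality, so that the
  row of \<open>a\<close> has the Fourier transform \<open>\<rho>\<^sub>i a\<close>; completeness
  makes it the only such function, and products are compared on transforms. Orthonormality of the
  rows is reduced to one column: by multiplicativity and the inversion rule, the inner product of
  the rows \<open>a\<close> and \<open>b\<close> is the entry at \<open>a b\<^sup>-\<^sup>1\<close>
  and the identity, which is the regular character of \<open>G\<close> divided by
  \<open>|G'|\<close>. It is 0 or 1 because \<open>|G| = |G'|\<close>, both being the sum of the
  \<open>d\<^sub>i\<^sup>2\<close>. No invariant inner product is averaged: the regular
  representation is already unitary, and its subrepresentations stay so in orthonormal bases. In the
  passage from a matrix to the degrees, the product condition neither mentions the identity nor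
  makes the adjoint multiplicative; unitarity supplies both.\<close>

section \<open>Matrix entries and linear combinations in coordinates\<close>

declare index_mult_mat(1) [simp del] index_mult_mat_vec [simp del]

text \<open>Entries are expanded into sums over \<open>{..<k}\<close> instead of scalar products of
  rows and columns, so that they can be interchanged with sums over a group.\<close>

lemma index_mult_mat_sum:
  assumes "A \<in> carrier_mat n k" "B \<in> carrier_mat k m" "i < n" "j < m"
  shows "(A * B) $$ (i,j) = (\<Sum>l<k. A $$ (i,l) * B $$ (l,j))"
  using assms by (auto simp: index_mult_mat(1) index_mult_mat_vec scalar_prod_def atLeast0LessThan intro!: sum.cong)

lemma index_mult_mat_vec_sum:
  assumes "A \<in> carrier_mat n k" "v \<in> carrier_vec k" "i < n"
  shows "(A *\<^sub>v v) $ i = (\<Sum>l<k. A $$ (i,l) * v $ l)"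
  using assms by (auto simp: index_mult_mat(1) index_mult_mat_vec scalar_prod_def atLeast0LessThan intro!: sum.cong)

lemma subspace_module_vec_iff:
  "VectorSpace.subspace class_ring W (module_vec TYPE(complex) n) \<longleftrightarrow>
     W \<subseteq> carrier_vec n \<and> 0\<^sub>v n \<in> W \<and> (\<forall>v\<in>W. \<forall>w\<in>W. v + w \<in> W) \<and> (\<forall>c. \<forall>v\<in>W. c \<cdot>\<^sub>v v \<in> W)"
proof -
  interpret vec_space "TYPE(complex)" n .
  show ?thesis
    unfolding VectorSpace.subspace_def submodule_def
    using vectorspace_axioms module_axioms
    by (auto simp: module_vec_simps)
qed

text \<open>An indexed family given in coordinates covers both uses: the columns of a matrix, and
  the vectors \<open>\<sigma> x *\<^sub>v w\<close> with \<open>x\<close> ranging over a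
  group.\<close>

lemma subspace_lincomb:
  assumes W: "VectorSpace.subspace class_ring W (module_vec TYPE(complex) n)"
    and "finite X" and "\<And>x. x \<in> X \<Longrightarrow> F x \<in> W"
  shows "vec n (\<lambda>i. \<Sum>x\<in>X. c x * F x $ i) \<in> W"
  using assms(2,3)
proof (induction X rule: finite_induct)
  case empty
  have "vec n (\<lambda>i. 0) = (0\<^sub>v n :: complex vec)" by auto
  then show ?case using W by (simp add: subspace_module_vec_iff)
next
  case (insert x X)
  have "F x \<in> carrier_vec n" using insert.prems W by (auto simp: subspace_module_vec_iff)
  then have "vec n (\<lambda>i. \<Sum>x\<in>insert x X. c x * F x $ i)
      = c x \<cdot>\<^sub>v F x + vec n (\<lambda>i. \<Sum>x\<in>X. c x * F x $ i)"
    using insert.hyps by auto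
  moreover have "c x \<cdot>\<^sub>v F x \<in> W" "vec n (\<lambda>i. \<Sum>x\<in>X. c x * F x $ i) \<in> W"
    using insert W by (auto simp: subspace_module_vec_iff)
  ultimately show ?case using W by (auto simp: subspace_module_vec_iff)
qed

lemma subspace_mat_mult_vec:
  assumes W: "VectorSpace.subspace class_ring W (module_vec TYPE(complex) n)"
    and V: "V \<in> carrier_mat n k" and "\<And>j. j < k \<Longrightarrow> col V j \<in> W" and u: "u \<in> carrier_vec k"
  shows "V *\<^sub>v u \<in> W"
proof -
  have "V *\<^sub>v u = vec n (\<lambda>i. \<Sum>j\<in>{..<k}. u $ j * col V j $ i)"
  proof
    fix i assume "i < dim_vec (vec n (\<lambda>i. \<Sum>j<k. u $ j * col V j $ i))"
    then show "(V *\<^sub>v u) $ i = vec n (\<lambda>i. \<Sum>j<k. u $ j * col V j $ i) $ i"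
      using V u by (auto simp: index_mult_mat_vec_sum[OF V u] mult.commute intro!: sum.cong)
  qed (use V in simp)
  also have "\<dots> \<in> W" using assms by (intro subspace_lincomb) auto
  finally show ?thesis .
qed

section \<open>Isometries onto subspaces\<close>

definition ctranspose :: "complex mat \<Rightarrow> complex mat" where
  "ctranspose A = mat (dim_col A) (dim_row A) (\<lambda>(i,j). cnj (A $$ (j,i)))"

lemma ctranspose_carrier [simp]: "A \<in> carrier_mat n m \<Longrightarrow> ctranspose A \<in> carrier_mat m n"
  by (auto simp: ctranspose_def)

lemma index_ctranspose [simp]:
  "A \<in> carrier_mat n m \<Longrightarrow> i < m \<Longrightarrow> j < n \<Longrightarrow> ctranspose A $$ (i,j) = cnj (A $$ (j,i))"
  by (auto simp: ctranspose_def)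

lemma ctranspose_mult:
  assumes A: "A \<in> carrier_mat n k" and B: "B \<in> carrier_mat k m"
  shows "ctranspose (A * B) = ctranspose B * ctranspose A"
proof (rule eq_matI)
  have AB: "A * B \<in> carrier_mat n m" using assms by simp
  fix i j assume "i < dim_row (ctranspose B * ctranspose A)" "j < dim_col (ctranspose B * ctranspose A)"
  then have ij: "i < m" "j < n" using assms by (auto simp: ctranspose_def)
  show "ctranspose (A * B) $$ (i,j) = (ctranspose B * ctranspose A) $$ (i,j)"
    using ij A B
    by (auto simp: index_ctranspose[OF AB] index_mult_mat_sum[OF A B]
        index_mult_mat_sum[OF ctranspose_carrier[OF B] ctranspose_carrier[OF A]]
        intro!: sum.cong)
qed (use assms in \<open>auto simp: ctranspose_def\<close>)

lemma ctranspose_ctranspose [simp]: "ctranspose (ctranspose A) = A"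
  by (rule eq_matI) (auto simp: ctranspose_def)

lemma isometry_dim_le:
  assumes V: "V \<in> carrier_mat n k" and iso: "ctranspose V * V = 1\<^sub>m k"
  shows "k \<le> n"
proof (rule ccontr)
  assume "\<not> k \<le> n"
  then have "n < k" by simp
  \<comment> \<open>Padded with zero rows to a square matrix, \<open>V\<close> would still have a left inverse.\<close>
  define A where "A = mat k k (\<lambda>(i,j). if i < n then V $$ (i,j) else 0)"
  define B where "B = mat k k (\<lambda>(i,j). if j < n then cnj (V $$ (j,i)) else 0)"
  have A: "A \<in> carrier_mat k k" and B: "B \<in> carrier_mat k k" by (auto simp: A_def B_def)
  have "B * A = ctranspose V * V"
  proof (rule eq_matI)
    fix i j assume "i < dim_row (ctranspose V * V)" "j < dim_col (ctranspose V * V)"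
    then have ij: "i < k" "j < k" using V by (auto simp: ctranspose_def)
    have "(B * A) $$ (i,j) = (\<Sum>l<k. if l < n then cnj (V $$ (l,i)) * V $$ (l,j) else 0)"
      using ij unfolding index_mult_mat_sum[OF B A ij] by (auto simp: A_def B_def intro!: sum.cong)
    also have "\<dots> = (\<Sum>l<n. cnj (V $$ (l,i)) * V $$ (l,j))"
      using \<open>n < k\<close> by (intro sum.mono_neutral_cong_right) auto
    also have "\<dots> = (ctranspose V * V) $$ (i,j)"
      using ij V by (auto simp: index_mult_mat_sum[OF ctranspose_carrier[OF V] V])
    finally show "(B * A) $$ (i,j) = (ctranspose V * V) $$ (i,j)" .
  qed (use V in \<open>auto simp: A_def B_def ctranspose_def\<close>)
  then have "A * B = 1\<^sub>m k" using iso by (intro mat_mult_left_right_inverse[OF B A]) simp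
  \<comment> \<open>Row \<open>n\<close> of \<open>A\<close> is a padding row, so
    \<open>A * B\<close> cannot be the unit matrix.\<close>
  moreover have "(A * B) $$ (n,n) = 0"
    using \<open>n < k\<close> unfolding index_mult_mat_sum[OF A B \<open>n < k\<close> \<open>n < k\<close>] by (auto simp: A_def intro!: sum.neutral)
  ultimately show False using \<open>n < k\<close> by simp
qed

text \<open>There is a largest \<open>k\<close> for which \<open>W\<close> contains \<open>k\<close>
  orthonormal vectors, as \<open>k\<close> is at most \<open>n\<close>. If some \<open>w\<close> in
  \<open>W\<close> differed from its projection onto their span, the normalised difference would be
  one vector more. So the columns of \<open>V\<close> are an orthonormal basis of \<open>W\<close>,
  and \<open>V * ctranspose V\<close> is the orthogonal projection onto \<open>W\<close>.\<close>

lemma subspace_isometry_exists: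
  assumes W: "VectorSpace.subspace class_ring W (module_vec TYPE(complex) n)"
  obtains k V where "V \<in> carrier_mat n k" "ctranspose V * V = 1\<^sub>m k"
    "\<And>j. j < k \<Longrightarrow> col V j \<in> W" "\<And>w. w \<in> W \<Longrightarrow> V *\<^sub>v (ctranspose V *\<^sub>v w) = w"
proof -
  define P where "P k \<longleftrightarrow> (\<exists>V\<in>carrier_mat n k. ctranspose V * V = 1\<^sub>m k \<and> (\<forall>j<k. col V j \<in> W))" for k
  have "P 0" unfolding P_def
    by (intro bexI[of _ "0\<^sub>m n 0"]) (auto simp: ctranspose_def)
  moreover have "\<forall>k. P k \<longrightarrow> k \<le> n" using isometry_dim_le by (auto simp: P_def)
  ultimately obtain k where k: "P k" "\<And>l. P l \<Longrightarrow> l \<le> k" using Greatest_le_nat GreatestI_nat by metis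
  then obtain V where V: "V \<in> carrier_mat n k" "ctranspose V * V = 1\<^sub>m k" "\<And>j. j < k \<Longrightarrow> col V j \<in> W"
    by (auto simp: P_def)
  have V': "ctranspose V \<in> carrier_mat k n" using V by simp
  have "V *\<^sub>v (ctranspose V *\<^sub>v w) = w" if w: "w \<in> W" for w
  proof (rule ccontr)
    assume neq: "V *\<^sub>v (ctranspose V *\<^sub>v w) \<noteq> w"
    have wc: "w \<in> carrier_vec n" using w W by (auto simp: subspace_module_vec_iff)
    define p where "p = V *\<^sub>v (ctranspose V *\<^sub>v w)"
    have pc: "p \<in> carrier_vec n" using V V' wc unfolding p_def by (meson mult_mat_vec_carrier)
    have pW: "p \<in> W" unfolding p_def using V mult_mat_vec_carrier[OF V' wc] W by (intro subspace_mat_mult_vec[of W n V k]) auto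
    \<comment> \<open>The component of \<open>w\<close> orthogonal to the columns of
      \<open>V\<close>; it lies in \<open>W\<close> and is nonzero by \<open>neq\<close>.\<close>
    define z where "z = w + (-1) \<cdot>\<^sub>v p"
    have zW: "z \<in> W" using w pW W unfolding z_def by (auto simp: subspace_module_vec_iff)
    have zc: "z \<in> carrier_vec n" using zW W by (auto simp: subspace_module_vec_iff)
    have "ctranspose V *\<^sub>v p = (ctranspose V * V) *\<^sub>v (ctranspose V *\<^sub>v w)"
      unfolding p_def using V V' wc by (metis assoc_mult_mat_vec mult_mat_vec_carrier)
    then have "ctranspose V *\<^sub>v p = ctranspose V *\<^sub>v w" using V(2) V' wc
      by (simp add: mult_mat_vec_carrier[OF V' wc])
    then have Vz: "ctranspose V *\<^sub>v z = 0\<^sub>v k"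
      using V' wc pc unfolding z_def
      by (subst mult_add_distrib_mat_vec[OF V']) (auto simp: mult_mat_vec[OF V'])
    obtain i0 where i0: "i0 < n" "z $ i0 \<noteq> 0"
    proof -
      have "\<exists>i<n. z $ i \<noteq> 0"
      proof (rule ccontr)
        assume "\<not> ?thesis"
        then have z0: "\<And>i. i < n \<Longrightarrow> z $ i = 0" by auto
        have "p = w"
        proof
          fix i assume i: "i < dim_vec w"
          then have "z $ i = w $ i - p $ i" using wc pc by (simp add: z_def)
          then show "p $ i = w $ i" using z0[of i] i wc by simp
        qed (use wc pc in auto)
        then show False using neq by (simp add: p_def)
      qed
      then show ?thesis using that by auto
    qed
    define s where "s = (\<Sum>i<n. (cmod (z $ i))\<^sup>2)"
    have "0 < (cmod (z $ i0))\<^sup>2" using i0 by simp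
    also have "\<dots> \<le> s" unfolding s_def using i0 by (intro member_le_sum) auto
    finally have s: "s > 0" .
    define u where "u = complex_of_real (1 / sqrt s) \<cdot>\<^sub>v z"
    have uW: "u \<in> W" and uc: "u \<in> carrier_vec n"
      using zW zc W by (auto simp: u_def subspace_module_vec_iff)
    have Vu: "(\<Sum>l<n. cnj (V $$ (l,j)) * u $ l) = 0" if "j < k" for j
    proof -
      have "(\<Sum>l<n. cnj (V $$ (l,j)) * z $ l) = (ctranspose V *\<^sub>v z) $ j"
        using that V(1) by (simp add: index_mult_mat_vec_sum[OF V' zc])
      also have "\<dots> = 0" using that by (simp add: Vz)
      finally show ?thesis using zc
        by (simp add: u_def flip: sum_divide_distrib)
    qed
    have uu: "(\<Sum>l<n. cnj (u $ l) * u $ l) = 1"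
    proof -
      have "cnj (u $ l) * u $ l = complex_of_real ((cmod (z $ l))\<^sup>2 / s)" if "l < n" for l
      proof -
        have "cnj (u $ l) * u $ l = complex_of_real ((cmod (u $ l))\<^sup>2)"
          by (metis complex_norm_square mult.commute)
        also have "(cmod (u $ l))\<^sup>2 = (cmod (z $ l))\<^sup>2 / s"
          using that zc s by (simp add: u_def norm_mult power_mult_distrib power_divide norm_divide)
        finally show ?thesis .
      qed
      then have "(\<Sum>l<n. cnj (u $ l) * u $ l) = complex_of_real (\<Sum>l<n. (cmod (z $ l))\<^sup>2 / s)"
        by simp
      also have "(\<Sum>l<n. (cmod (z $ l))\<^sup>2 / s) = 1"
        using s by (simp add: s_def flip: sum_divide_distrib)
      finally show ?thesis by simp
    qed
    define V1 where "V1 = mat n (Suc k) (\<lambda>(i,j). if j < k then V $$ (i,j) else u $ i)"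
    have V1: "V1 \<in> carrier_mat n (Suc k)" by (simp add: V1_def)
    have VV: "(\<Sum>l<n. cnj (V $$ (l,i)) * V $$ (l,j)) = (if i = j then 1 else 0)" if "i < k" "j < k" for i j
    proof -
      have "(\<Sum>l<n. cnj (V $$ (l,i)) * V $$ (l,j)) = (ctranspose V * V) $$ (i,j)"
        using that V(1) by (simp add: index_mult_mat_sum[OF V' V(1)])
      then show ?thesis using V(2) that by simp
    qed
    have Vu': "(\<Sum>l<n. cnj (u $ l) * V $$ (l,j)) = 0" if "j < k" for j
    proof -
      have "cnj (\<Sum>l<n. cnj (u $ l) * V $$ (l,j)) = 0" using Vu[OF that] by (simp add: mult.commute)
      then show ?thesis by (metis complex_cnj_zero_iff)
    qed
    have "ctranspose V1 * V1 = 1\<^sub>m (Suc k)"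
    proof (rule eq_matI)
      fix i j assume "i < dim_row (1\<^sub>m (Suc k) :: complex mat)" "j < dim_col (1\<^sub>m (Suc k) :: complex mat)"
      then have ij: "i < Suc k" "j < Suc k" by auto
      have "(ctranspose V1 * V1) $$ (i,j) = (\<Sum>l<n. cnj (V1 $$ (l,i)) * V1 $$ (l,j))"
        using ij V1 by (simp add: index_mult_mat_sum[OF ctranspose_carrier[OF V1] V1])
      also have "\<dots> = (if i = j then 1 else 0)"
        using ij VV Vu Vu' uu by (cases "i < k"; cases "j < k") (auto simp: V1_def less_Suc_eq)
      finally show "(ctranspose V1 * V1) $$ (i,j) = 1\<^sub>m (Suc k) $$ (i,j)" using ij by simp
    qed (auto simp: V1_def ctranspose_def)
    moreover have "col V1 j \<in> W" if "j < Suc k" for j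
    proof (cases "j < k")
      case True
      have "col V1 j = col V j" using True V by (intro eq_vecI) (auto simp: V1_def)
      then show ?thesis using V(3) True by simp
    next
      case False
      have "col V1 j = u" using False that uc by (intro eq_vecI) (auto simp: V1_def)
      then show ?thesis using uW by simp
    qed
    ultimately have "P (Suc k)" using V1 by (auto simp: P_def)
    then show False using k(2) by fastforce
  qed
  then show ?thesis using that V by blast
qed

section \<open>Representations\<close>

lemma mult_mat_zero_vec: "A \<in> carrier_mat n m \<Longrightarrow> A *\<^sub>v 0\<^sub>v m = 0\<^sub>v n"
  by (auto simp: index_mult_mat_vec scalar_prod_def intro!: eq_vecI)

lemma index_mult_mat_unit_vec:
  "(A :: 'a :: semiring_1 mat) \<in> carrier_mat n m \<Longrightarrow> i < n \<Longrightarrow> j < m \<Longrightarrow> (A *\<^sub>v unit_vec m j) $ i = A $$ (i,j)"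
  by (auto simp: index_mult_mat_vec)

lemma carrier_GL:
  "carrier (GL n) = {A \<in> carrier_mat n n. \<exists>B\<in>carrier_mat n n. B * A = 1\<^sub>m n \<and> A * B = 1\<^sub>m n}"
  by (auto simp: GL_def units_of_def Units_def ring_mat_simps)

lemma mult_GL: "A \<otimes>\<^bsub>GL n\<^esub> B = A * B"
  by (simp add: GL_def units_of_def ring_mat_simps)

lemma one_GL: "\<one>\<^bsub>GL n\<^esub> = 1\<^sub>m n"
  by (simp add: GL_def units_of_def ring_mat_simps)

lemma group_GL: "group (GL n)"
proof -
  interpret ring "ring_mat TYPE(complex) n ()" by (rule ring_mat)
  show ?thesis unfolding GL_def by (rule units_group)
qed

locale finite_group = group G for G :: "('a, 'm) monoid_scheme" (structure) +
  assumes fin: "finite (carrier G)"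
begin

abbreviation N :: complex where "N \<equiv> of_nat (card (carrier G))"

lemma card_carrier_nonzero: "N \<noteq> 0"
  using fin one_closed by auto

lemma sum_translate: "h \<in> carrier G \<Longrightarrow> (\<Sum>g\<in>carrier G. f (h \<otimes> g)) = (\<Sum>g\<in>carrier G. f g)"
  by (rule sum.reindex_bij_witness[of _ "\<lambda>g. inv h \<otimes> g" "\<lambda>g. h \<otimes> g"])
     (auto simp flip: m_assoc)

text \<open>Once \<open>\<rho> \<one>\<close> is the unit matrix, \<open>\<rho> (inv g)\<close>
  inverts \<open>\<rho> g\<close>. Invertibility of all matrices is thus traded for one
  equation.\<close>

lemma representation_iff:
  "representation G n \<rho> \<longleftrightarrow>
     (\<forall>g\<in>carrier G. \<rho> g \<in> carrier_mat n n) \<and>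
     (\<forall>g\<in>carrier G. \<forall>h\<in>carrier G. \<rho> (g \<otimes> h) = \<rho> g * \<rho> h) \<and> \<rho> \<one> = 1\<^sub>m n" (is "?L \<longleftrightarrow> ?R")
proof
  assume ?L
  then have h: "\<rho> \<in> hom G (GL n)" by (simp add: representation_def)
  show ?R using hom_one[OF h is_group group_GL] hom_mult[OF h] hom_in_carrier[OF h]
    by (auto simp: one_GL mult_GL carrier_GL)
next
  assume R: ?R
  show ?L unfolding representation_def
  proof (rule homI)
    fix g assume g: "g \<in> carrier G"
    have "\<rho> (inv g) * \<rho> g = 1\<^sub>m n" "\<rho> g * \<rho> (inv g) = 1\<^sub>m n"
      using R g by (metis inv_closed l_inv, metis inv_closed r_inv)
    then show "\<rho> g \<in> carrier (GL n)" using R g by (auto simp: carrier_GL)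
  qed (use R in \<open>auto simp: mult_GL\<close>)
qed

context
  fixes n \<rho> assumes rep: "representation G n \<rho>"
begin

lemma rep_carrier: "g \<in> carrier G \<Longrightarrow> \<rho> g \<in> carrier_mat n n"
  using rep by (simp add: representation_iff)

lemma rep_mult: "g \<in> carrier G \<Longrightarrow> h \<in> carrier G \<Longrightarrow> \<rho> (g \<otimes> h) = \<rho> g * \<rho> h"
  using rep by (simp add: representation_iff)

lemma rep_one: "\<rho> \<one> = 1\<^sub>m n"
  using rep by (simp add: representation_iff)

lemma rep_mult_index:
  "g \<in> carrier G \<Longrightarrow> h \<in> carrier G \<Longrightarrow> i < n \<Longrightarrow> j < n \<Longrightarrow>
     \<rho> (g \<otimes> h) $$ (i,j) = (\<Sum>k<n. \<rho> g $$ (i,k) * \<rho> h $$ (k,j))"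
  by (simp add: rep_mult index_mult_mat_sum[OF rep_carrier rep_carrier])

lemma rep_degree_eq: "rep_degree G \<rho> = n"
  using rep_carrier[of \<one>] by (simp add: rep_degree_def)

end

text \<open>This and the next two rules allow passing between maps that agree on the group only,
  such as a representation and its extensional restriction.\<close>

lemma representation_cong:
  assumes "\<And>g. g \<in> carrier G \<Longrightarrow> \<rho> g = \<sigma> g"
  shows "representation G n \<rho> = representation G n \<sigma>"
  using assms by (simp add: representation_iff)

lemma invariant_subspace_cong:
  assumes "\<And>g. g \<in> carrier G \<Longrightarrow> \<rho> g = \<sigma> g"
  shows "invariant_subspace G n \<rho> = invariant_subspace G n \<sigma>"
  using assms by (simp add: invariant_subspace_def fun_eq_iff)

lemma irreducible_representation_cong:
  assumes "\<And>g. g \<in> carrier G \<Longrightarrow> \<rho> g = \<sigma> g"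
  shows "irreducible_representation G n \<rho> = irreducible_representation G n \<sigma>"
  by (simp add: irreducible_representation_def representation_cong[OF assms]
      invariant_subspace_cong[OF assms])

lemma equivalent_representations_degree:
  "equivalent_representations G \<rho> \<sigma> \<Longrightarrow> rep_degree G \<rho> = rep_degree G \<sigma>"
  by (auto simp: equivalent_representations_def rep_degree_eq)

lemma equivalent_representations_refl:
  "representation G n \<rho> \<Longrightarrow> equivalent_representations G \<rho> \<rho>"
  unfolding equivalent_representations_def carrier_GL
  by (intro exI[of _ n] conjI bexI[of _ "1\<^sub>m n"]) (auto dest: rep_carrier intro!: bexI[of _ "1\<^sub>m n"])

lemma equivalent_representations_sym:
  assumes "equivalent_representations G \<rho> \<sigma>"
  shows "equivalent_representations G \<sigma> \<rho>"
proof -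
  obtain n P Q where n: "representation G n \<rho>" "representation G n \<sigma>"
    and P: "P \<in> carrier_mat n n" and Q: "Q \<in> carrier_mat n n" "Q * P = 1\<^sub>m n" "P * Q = 1\<^sub>m n"
    and PQ: "\<forall>g\<in>carrier G. P * \<rho> g = \<sigma> g * P"
    using assms by (auto simp: equivalent_representations_def carrier_GL)
  have "Q * \<sigma> g = \<rho> g * Q" if g: "g \<in> carrier G" for g
  proof -
    note c = rep_carrier[OF n(1) g] rep_carrier[OF n(2) g] P Q(1)
    have "Q * \<sigma> g = Q * (\<sigma> g * (P * Q))" using Q(3) c by simp
    also have "\<dots> = Q * ((\<sigma> g * P) * Q)" using c by (simp add: assoc_mult_mat[OF c(2) c(3) c(4)])
    also have "\<dots> = Q * ((P * \<rho> g) * Q)" using PQ g by simp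
    also have "\<dots> = (Q * P) * (\<rho> g * Q)" using c by (simp add: assoc_mult_mat[OF c(3) c(1) c(4)] assoc_mult_mat[OF c(4) c(3) mult_carrier_mat[OF c(1) c(4)]])
    also have "\<dots> = \<rho> g * Q" using Q(2) c by simp
    finally show ?thesis .
  qed
  then show ?thesis using n P Q unfolding equivalent_representations_def carrier_GL
    by (intro exI[of _ n] conjI bexI[of _ Q]) auto
qed

lemma equivalent_representations_trans:
  assumes "equivalent_representations G \<rho> \<sigma>" "equivalent_representations G \<sigma> \<tau>"
  shows "equivalent_representations G \<rho> \<tau>"
proof -
  obtain n P where n: "representation G n \<rho>" "representation G n \<sigma>"
    and P: "P \<in> carrier (GL n)" and PP: "\<forall>g\<in>carrier G. P * \<rho> g = \<sigma> g * P"
    using assms by (auto simp: equivalent_representations_def)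
  obtain m Q where m: "representation G m \<sigma>" "representation G m \<tau>"
    and Q: "Q \<in> carrier (GL m)" and QQ: "\<forall>g\<in>carrier G. Q * \<sigma> g = \<tau> g * Q"
    using assms by (auto simp: equivalent_representations_def)
  \<comment> \<open>Each equivalence comes with its own degree; both are the degree of
    \<open>\<sigma>\<close>.\<close>
  have mn: "m = n" using rep_degree_eq[OF n(2)] rep_degree_eq[OF m(1)] by simp
  have c: "P \<in> carrier_mat n n" "Q \<in> carrier_mat n n" using P Q mn by (auto simp: carrier_GL)
  have "Q * P \<in> carrier (GL n)" using P Q mn group.is_monoid[OF group_GL[of n]]
    by (metis monoid.m_closed mult_GL)
  moreover have "(Q * P) * \<rho> g = \<tau> g * (Q * P)" if g: "g \<in> carrier G" for g
  proof -
    note c = c rep_carrier[OF n(1) g] rep_carrier[OF n(2) g] rep_carrier[OF m(2)[unfolded mn] g]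
    have "(Q * P) * \<rho> g = Q * (\<sigma> g * P)" using c PP g by simp
    also have "\<dots> = (\<tau> g * Q) * P" using c QQ g by (simp flip: assoc_mult_mat[OF c(2) c(4) c(1)])
    also have "\<dots> = \<tau> g * (Q * P)" using c by simp
    finally show ?thesis .
  qed
  ultimately show ?thesis using n m mn unfolding equivalent_representations_def by blast
qed

abbreviation irrep_rel where
  "irrep_rel \<equiv> {(\<rho>, \<sigma>). \<rho> \<in> irreps G \<and> \<sigma> \<in> irreps G \<and> equivalent_representations G \<rho> \<sigma>}"

lemma equiv_irrep_rel: "equiv (irreps G) irrep_rel"
proof (rule equivI)
  show "irrep_rel \<subseteq> irreps G \<times> irreps G" by auto
  show "refl_on (irreps G) irrep_rel"
    by (auto simp: refl_on_def irreps_def irreducible_representation_def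
        intro: equivalent_representations_refl)
  show "sym irrep_rel" by (auto simp: sym_def intro: equivalent_representations_sym)
  show "trans irrep_rel" by (auto simp: trans_def intro: equivalent_representations_trans)
qed

section \<open>Schur orthogonality\<close>

text \<open>Kernel and range of \<open>T\<close> are invariant subspaces, so a nonzero
  \<open>T\<close> is injective and surjective. As \<open>T\<close> is not square a priori,
  \<open>n = m\<close> is part of the conclusion.\<close>

lemma schur_lemma:
  assumes \<rho>: "irreducible_representation G n \<rho>" and \<sigma>: "irreducible_representation G m \<sigma>"
    and T: "T \<in> carrier_mat n m" and comm: "\<And>h. h \<in> carrier G \<Longrightarrow> \<rho> h * T = T * \<sigma> h"
  shows "T = 0\<^sub>m n m \<or> (n = m \<and> T \<in> carrier (GL n))"
proof (cases "T = 0\<^sub>m n m")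
  case False
  have rep: "representation G n \<rho>" "representation G m \<sigma>"
    using \<rho> \<sigma> by (auto simp: irreducible_representation_def)
  note c = rep_carrier[OF rep(1)] rep_carrier[OF rep(2)]
  have T_cols: "(\<forall>v\<in>carrier_vec m. T *\<^sub>v v = 0\<^sub>v n) \<Longrightarrow> T = 0\<^sub>m n m"
  proof (rule eq_matI)
    fix i j assume *: "\<forall>v\<in>carrier_vec m. T *\<^sub>v v = 0\<^sub>v n"
      and ij: "i < dim_row (0\<^sub>m n m :: complex mat)" "j < dim_col (0\<^sub>m n m :: complex mat)"
    have "T $$ (i,j) = (T *\<^sub>v unit_vec m j) $ i"
      using ij T by (simp add: index_mult_mat_unit_vec)
    then show "T $$ (i,j) = 0\<^sub>m n m $$ (i,j)" using * ij by simp
  qed (use T in auto)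
  define K where "K = {v \<in> carrier_vec m. T *\<^sub>v v = 0\<^sub>v n}"
  have "invariant_subspace G m \<sigma> K"
    unfolding invariant_subspace_def subspace_module_vec_iff
  proof (intro conjI ballI allI)
    show "0\<^sub>v m \<in> K" using T by (auto simp: K_def mult_mat_zero_vec)
    show "v + w \<in> K" if "v \<in> K" "w \<in> K" for v w
      using that T by (auto simp: K_def mult_add_distrib_mat_vec[OF T])
    show "x \<cdot>\<^sub>v v \<in> K" if "v \<in> K" for x v
      using that T by (auto simp: K_def mult_mat_vec[OF T])
    show "\<sigma> g *\<^sub>v w \<in> K" if "g \<in> carrier G" "w \<in> K" for g w
    proof -
      have w: "w \<in> carrier_vec m" "T *\<^sub>v w = 0\<^sub>v n" using that by (auto simp: K_def)
      have "T *\<^sub>v (\<sigma> g *\<^sub>v w) = (T * \<sigma> g) *\<^sub>v w" using w c(2)[OF that(1)] T by simp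
      also have "\<dots> = \<rho> g *\<^sub>v (T *\<^sub>v w)"
        by (simp only: comm[OF that(1), symmetric] assoc_mult_mat_vec[OF c(1)[OF that(1)] T w(1)])
      also have "\<dots> = 0\<^sub>v n" using w c(1)[OF that(1)] by (simp add: mult_mat_zero_vec)
      finally show ?thesis using w c(2)[OF that(1)] by (auto simp: K_def intro: mult_mat_vec_carrier)
    qed
  qed (auto simp: K_def)
  then have "K = {0\<^sub>v m} \<or> K = carrier_vec m"
    using \<sigma> by (auto simp: irreducible_representation_def)
  then have K: "K = {0\<^sub>v m}" using T_cols False by (auto simp: K_def)
  define R where "R = (\<lambda>v. T *\<^sub>v v) ` carrier_vec m"
  have "invariant_subspace G n \<rho> R"
    unfolding invariant_subspace_def subspace_module_vec_iff
  proof (intro conjI ballI allI)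
    show "R \<subseteq> carrier_vec n" using T by (auto simp: R_def intro: mult_mat_vec_carrier)
    show "0\<^sub>v n \<in> R" using T unfolding R_def by (intro image_eqI[of _ _ "0\<^sub>v m"]) (auto simp: mult_mat_zero_vec)
    show "v + w \<in> R" if "v \<in> R" "w \<in> R" for v w
      using that T by (auto simp: R_def simp flip: mult_add_distrib_mat_vec[OF T])
    show "x \<cdot>\<^sub>v v \<in> R" if "v \<in> R" for x v
      using that T by (auto simp: R_def simp flip: mult_mat_vec[OF T])
    show "\<rho> g *\<^sub>v w \<in> R" if g: "g \<in> carrier G" and w: "w \<in> R" for g w
    proof -
      obtain v where v: "v \<in> carrier_vec m" "w = T *\<^sub>v v" using w by (auto simp: R_def)
      have "\<rho> g *\<^sub>v w = T *\<^sub>v (\<sigma> g *\<^sub>v v)"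
        by (simp only: v(2) comm[OF g] flip: assoc_mult_mat_vec[OF c(1)[OF g] T v(1)]
            assoc_mult_mat_vec[OF T c(2)[OF g] v(1)])
      then show ?thesis using mult_mat_vec_carrier[OF c(2)[OF g] v(1)] by (auto simp: R_def)
    qed
  qed
  then have "R = {0\<^sub>v n} \<or> R = carrier_vec n"
    using \<rho> by (auto simp: irreducible_representation_def)
  then have R: "R = carrier_vec n" using T_cols False by (auto simp: R_def)
  \<comment> \<open>Surjectivity gives a preimage of every unit vector; these are the columns of a
    right inverse.\<close>
  have "\<forall>i<n. \<exists>v\<in>carrier_vec m. T *\<^sub>v v = unit_vec n i"
  proof (intro allI impI)
    fix i assume "i < n"
    have "unit_vec n i \<in> R" unfolding R by simp
    then show "\<exists>v\<in>carrier_vec m. T *\<^sub>v v = unit_vec n i" by (auto simp: R_def)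
  qed
  then obtain b where b: "\<And>i. i < n \<Longrightarrow> b i \<in> carrier_vec m \<and> T *\<^sub>v b i = unit_vec n i" by metis
  define B where "B = mat m n (\<lambda>(i,j). b j $ i)"
  have B: "B \<in> carrier_mat m n" by (simp add: B_def)
  have TB: "T * B = 1\<^sub>m n"
  proof (rule eq_matI)
    fix i j assume "i < dim_row (1\<^sub>m n :: complex mat)" "j < dim_col (1\<^sub>m n :: complex mat)"
    then have ij: "i < n" "j < n" by auto
    have "(T * B) $$ (i,j) = (T *\<^sub>v b j) $ i"
      using ij unfolding index_mult_mat_sum[OF T B ij] index_mult_mat_vec_sum[OF T conjunct1[OF b[OF ij(2)]] ij(1)]
      by (auto simp: B_def)
    then show "(T * B) $$ (i,j) = 1\<^sub>m n $$ (i,j)" using ij b by simp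
  qed (use T B in auto)
  have BT: "B * T = 1\<^sub>m m"
  proof (rule eq_matI)
    fix i j assume "i < dim_row (1\<^sub>m m :: complex mat)" "j < dim_col (1\<^sub>m m :: complex mat)"
    then have ij: "i < m" "j < m" by auto
    \<comment> \<open>From \<open>T * B = 1\<close> it follows that \<open>T\<close> kills the
      difference between \<open>B * T\<close> and the identity on every unit vector; injectivity of
      \<open>T\<close> finishes.\<close>
    define v where "v = (B * T) *\<^sub>v unit_vec m j - unit_vec m j"
    have BTc: "B * T \<in> carrier_mat m m" using B T by simp
    then have vc: "v \<in> carrier_vec m" by (simp add: v_def)
    have "T *\<^sub>v ((B * T) *\<^sub>v unit_vec m j) = (T * B) *\<^sub>v (T *\<^sub>v unit_vec m j)"
      using mult_mat_vec_carrier[OF T unit_vec_carrier[of m j]]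
      by (simp add: assoc_mult_mat_vec[OF B T] assoc_mult_mat_vec[OF T B])
    also have "\<dots> = T *\<^sub>v unit_vec m j" using TB T by simp
    finally have "T *\<^sub>v v = 0\<^sub>v n" using BTc T unfolding v_def
      by (subst mult_minus_distrib_mat_vec[OF T]) auto
    then have "v \<in> K" using vc by (simp add: K_def)
    then have v0: "v = 0\<^sub>v m" using K by simp
    have "(B * T) $$ (i,j) = ((B * T) *\<^sub>v unit_vec m j) $ i"
      using ij BTc by (simp add: index_mult_mat_unit_vec)
    moreover have "v $ i = ((B * T) *\<^sub>v unit_vec m j) $ i - unit_vec m j $ i"
      unfolding v_def using ij by simp
    ultimately show "(B * T) $$ (i,j) = 1\<^sub>m m $$ (i,j)" using ij v0 by simp
  qed (use T B in auto)
  \<comment> \<open>The traces of \<open>T * B\<close> and \<open>B * T\<close> agree, so the two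
    unit matrices have the same size.\<close>
  have "(of_nat n :: complex) = (\<Sum>i<n. (T * B) $$ (i,i))" by (simp add: TB)
  also have "\<dots> = (\<Sum>i<n. \<Sum>j<m. T $$ (i,j) * B $$ (j,i))"
    by (simp add: index_mult_mat_sum[OF T B])
  also have "\<dots> = (\<Sum>j<m. \<Sum>i<n. B $$ (j,i) * T $$ (i,j))"
    by (subst sum.swap) (simp add: mult.commute)
  also have "\<dots> = (\<Sum>j<m. (B * T) $$ (j,j))"
    by (simp add: index_mult_mat_sum[OF B T])
  also have "\<dots> = of_nat m" by (simp add: BT)
  finally have "n = m" by simp
  then show ?thesis using T B TB BT by (auto simp: carrier_GL)
qed simp

text \<open>\<open>T\<close> is the sum over \<open>g\<close> of \<rho>(g) E \<sigma>(inv g), where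
  \<open>E\<close> is the matrix unit with its entry 1 at \<open>(p,q)\<close>. Translating the
  summation variable moves \<open>h\<close> from one side to the other.\<close>

lemma averaged_intertwiner:
  assumes \<rho>: "representation G n \<rho>" and \<sigma>: "representation G m \<sigma>"
    and T: "T = mat n m (\<lambda>(i,j). \<Sum>g\<in>carrier G. \<rho> g $$ (i,p) * \<sigma> (inv g) $$ (q,j))"
    and "p < n" "q < m" and h: "h \<in> carrier G"
  shows "\<rho> h * T = T * \<sigma> h"
proof (rule eq_matI)
  have Tc: "T \<in> carrier_mat n m" by (simp add: T)
  note c = rep_carrier[OF \<rho> h] rep_carrier[OF \<sigma> h]
  fix i j assume "i < dim_row (T * \<sigma> h)" "j < dim_col (T * \<sigma> h)"
  then have ij: "i < n" "j < m" using c Tc by auto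
  have "(\<rho> h * T) $$ (i,j) = (\<Sum>k<n. \<Sum>g\<in>carrier G. \<rho> h $$ (i,k) * \<rho> g $$ (k,p) * \<sigma> (inv g) $$ (q,j))"
    using ij unfolding index_mult_mat_sum[OF c(1) Tc ij]
    by (auto simp: T sum_distrib_left mult.assoc)
  also have "\<dots> = (\<Sum>g\<in>carrier G. \<rho> (h \<otimes> g) $$ (i,p) * \<sigma> (inv g) $$ (q,j))"
    using assms ij by (subst sum.swap) (simp add: rep_mult_index[OF \<rho>] sum_distrib_right)
  \<comment> \<open>Rewriting \<open>inv g\<close> in terms of \<open>h \<otimes> g\<close> makes
    the whole summand a function of \<open>h \<otimes> g\<close>.\<close>
  also have "\<dots> = (\<Sum>g\<in>carrier G. \<rho> (h \<otimes> g) $$ (i,p) * \<sigma> (inv (h \<otimes> g) \<otimes> h) $$ (q,j))"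
    using h by (intro sum.cong) (auto simp: inv_mult_group m_assoc)
  also have "\<dots> = (\<Sum>g\<in>carrier G. \<rho> g $$ (i,p) * \<sigma> (inv g \<otimes> h) $$ (q,j))"
    by (rule sum_translate[OF h])
  also have "\<dots> = (\<Sum>g\<in>carrier G. \<Sum>k<m. \<rho> g $$ (i,p) * (\<sigma> (inv g) $$ (q,k) * \<sigma> h $$ (k,j)))"
    using assms ij by (simp add: rep_mult_index[OF \<sigma>] sum_distrib_left)
  also have "\<dots> = (T * \<sigma> h) $$ (i,j)"
    using ij unfolding index_mult_mat_sum[OF Tc c(2) ij]
    by (subst sum.swap) (auto simp: T sum_distrib_right mult.assoc)
  finally show "(\<rho> h * T) $$ (i,j) = (T * \<sigma> h) $$ (i,j)" .
qed (use rep_carrier[OF \<rho> h] rep_carrier[OF \<sigma> h] in \<open>auto simp: T\<close>)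

text \<open>The sums are the entries of an averaged intertwiner; if it were invertible, it would be
  an equivalence from \<open>\<sigma>\<close> to \<open>\<rho>\<close>, so it is zero.\<close>

lemma schur_orthogonality_inequivalent:
  assumes \<rho>: "irreducible_representation G n \<rho>" and \<sigma>: "irreducible_representation G m \<sigma>"
    and neq: "\<not> equivalent_representations G \<sigma> \<rho>" and ijpq: "i < n" "p < n" "q < m" "j < m"
  shows "(\<Sum>g\<in>carrier G. \<rho> g $$ (i,p) * \<sigma> (inv g) $$ (q,j)) = 0"
proof -
  have rep: "representation G n \<rho>" "representation G m \<sigma>"
    using \<rho> \<sigma> by (auto simp: irreducible_representation_def)
  define T where "T = mat n m (\<lambda>(i,j). \<Sum>g\<in>carrier G. \<rho> g $$ (i,p) * \<sigma> (inv g) $$ (q,j))"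
  note comm = averaged_intertwiner[OF rep T_def ijpq(2,3)]
  have "T = 0\<^sub>m n m \<or> (n = m \<and> T \<in> carrier (GL n))"
    using comm by (intro schur_lemma[OF \<rho> \<sigma>]) (auto simp: T_def)
  moreover have "\<not> (n = m \<and> T \<in> carrier (GL n))"
    using neq rep comm unfolding equivalent_representations_def by metis
  ultimately have "T $$ (i,j) = 0" using ijpq by simp
  then show ?thesis using ijpq by (simp add: T_def)
qed

text \<open>The averaged intertwiner minus an eigenvalue is a singular intertwiner, hence zero. So
  it is a scalar matrix, and its trace determines the scalar.\<close>

lemma schur_orthogonality_same:
  assumes \<rho>: "irreducible_representation G n \<rho>" and ijpq: "i < n" "p < n" "q < n" "j < n"
  shows "(\<Sum>g\<in>carrier G. \<rho> g $$ (i,p) * \<rho> (inv g) $$ (q,j)) = (if i = j \<and> p = q then N / of_nat n else 0)"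
proof -
  have rep: "representation G n \<rho>"
    using \<rho> by (auto simp: irreducible_representation_def)
  define T where "T = mat n n (\<lambda>(i,j). \<Sum>g\<in>carrier G. \<rho> g $$ (i,p) * \<rho> (inv g) $$ (q,j))"
  have T: "T \<in> carrier_mat n n" by (simp add: T_def)
  note comm = averaged_intertwiner[OF rep rep T_def ijpq(2,3)]
  have "n > 0" using ijpq by simp
  then obtain c where "eigenvalue T c" using spectrum_non_empty[OF T] by (auto simp: spectrum_def)
  then obtain v where v: "v \<in> carrier_vec n" "v \<noteq> 0\<^sub>v n" "T *\<^sub>v v = c \<cdot>\<^sub>v v"
    using T by (auto simp: eigenvalue_def eigenvector_def)
  define S where "S = T + (- c) \<cdot>\<^sub>m 1\<^sub>m n"
  have S: "S \<in> carrier_mat n n" using T by (simp add: S_def)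
  have "S *\<^sub>v v = 0\<^sub>v n"
  proof -
    have "S *\<^sub>v v = T *\<^sub>v v + ((- c) \<cdot>\<^sub>m 1\<^sub>m n) *\<^sub>v v"
      unfolding S_def using T v by (intro add_mult_distrib_mat_vec) auto
    also have "((- c) \<cdot>\<^sub>m 1\<^sub>m n) *\<^sub>v v = (- c) \<cdot>\<^sub>v v"
      using v by (intro eq_vecI) (auto simp: index_mult_mat_vec)
    finally show ?thesis using v by auto
  qed
  then have "S \<notin> carrier (GL n)"
  proof -
    have False if B: "B \<in> carrier_mat n n" "B * S = 1\<^sub>m n" for B
    proof -
      have "v = (B * S) *\<^sub>v v" using B v by simp
      also have "\<dots> = B *\<^sub>v (S *\<^sub>v v)" using B(1) S v by simp
      also have "\<dots> = 0\<^sub>v n" using B(1) \<open>S *\<^sub>v v = 0\<^sub>v n\<close> by (simp add: mult_mat_zero_vec)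
      finally show False using v by simp
    qed
    then show ?thesis by (auto simp: carrier_GL)
  qed
  moreover have "S = 0\<^sub>m n n \<or> (n = n \<and> S \<in> carrier (GL n))"
  proof (rule schur_lemma[OF \<rho> \<rho> S])
    fix h assume h: "h \<in> carrier G"
    note c = rep_carrier[OF rep h]
    have "\<rho> h * S = \<rho> h * T + \<rho> h * ((- c) \<cdot>\<^sub>m 1\<^sub>m n)"
      unfolding S_def using c T by (intro mult_add_distrib_mat) auto
    also have "\<dots> = T * \<rho> h + ((- c) \<cdot>\<^sub>m 1\<^sub>m n) * \<rho> h"
      using c T comm[OF h] by (simp add: mult_smult_distrib[of _ n n _ n] mult_smult_assoc_mat[of _ n n _ n])
    also have "\<dots> = S * \<rho> h"
      unfolding S_def using c T by (intro add_mult_distrib_mat[symmetric]) auto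
    finally show "\<rho> h * S = S * \<rho> h" .
  qed
  ultimately have S0: "S = 0\<^sub>m n n" by simp
  have Tij: "T $$ (k,l) = (if k = l then c else 0)" if "k < n" "l < n" for k l
  proof -
    have "S $$ (k,l) = T $$ (k,l) + (- c) * (if k = l then 1 else 0)"
      using that T by (simp add: S_def)
    then show ?thesis using S0 that by (auto split: if_splits)
  qed
  \<comment> \<open>The trace of \<open>T\<close>, computed in two ways: summing over the diagonal
    first multiplies \<open>\<rho> (inv g)\<close> with \<open>\<rho> g\<close> and leaves an entry
    of the unit matrix for each \<open>g\<close>.\<close>
  have "of_nat n * c = (\<Sum>k<n. T $$ (k,k))" by (simp add: Tij)
  also have "\<dots> = (\<Sum>g\<in>carrier G. \<Sum>k<n. \<rho> (inv g) $$ (q,k) * \<rho> g $$ (k,p))"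
    by (subst sum.swap) (simp add: T_def mult.commute)
  also have "\<dots> = (\<Sum>g\<in>carrier G. \<rho> (inv g \<otimes> g) $$ (q,p))"
    using ijpq by (intro sum.cong) (simp_all del: l_inv flip: rep_mult_index[OF rep])
  also have "\<dots> = (if p = q then N else 0)" using ijpq by (simp add: rep_one[OF rep])
  finally have "c = (if p = q then N / of_nat n else 0)"
    using \<open>n > 0\<close> by (auto simp: field_simps split: if_splits)
  moreover have "(\<Sum>g\<in>carrier G. \<rho> g $$ (i,p) * \<rho> (inv g) $$ (q,j)) = T $$ (i,j)"
    using ijpq by (simp add: T_def)
  ultimately show ?thesis using Tij ijpq by simp
qed

section \<open>Unitary representations\<close>

text \<open>Since \<open>\<rho> (inv g)\<close> is the inverse of \<open>\<rho> g\<close>, this says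
  that every \<open>\<rho> g\<close> is unitary, in the form needed for conjugating
  coefficients.\<close>

definition unitary_representation :: "nat \<Rightarrow> ('a \<Rightarrow> complex mat) \<Rightarrow> bool" where
  "unitary_representation n \<rho> \<longleftrightarrow>
     representation G n \<rho> \<and> (\<forall>g\<in>carrier G. \<rho> (inv g) = ctranspose (\<rho> g))"

text \<open>The linear extension of \<open>\<rho>\<close> to the group algebra kills the element
  with coefficients \<open>f\<close>.\<close>

definition annihilates :: "('a \<Rightarrow> complex) \<Rightarrow> nat \<Rightarrow> ('a \<Rightarrow> complex mat) \<Rightarrow> bool" where
  "annihilates f n \<rho> \<longleftrightarrow> (\<forall>i<n. \<forall>j<n. (\<Sum>g\<in>carrier G. f g * \<rho> g $$ (i,j)) = 0)"

text \<open>With an orthonormal basis of \<open>W\<close> as the columns of \<open>V\<close>, the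
  compression \<open>ctranspose V * \<rho> g * V\<close> is the restriction of \<open>\<rho>\<close>
  to \<open>W\<close>. Compatibility with conjugate transposes is immediate; multiplicativity rests
  on the intertwining relation, which expresses the invariance of \<open>W\<close>.\<close>

lemma unitary_subrepresentation:
  assumes \<rho>: "unitary_representation n \<rho>" and W: "invariant_subspace G n \<rho> W"
  obtains k V where "V \<in> carrier_mat n k" "ctranspose V * V = 1\<^sub>m k"
    "\<And>j. j < k \<Longrightarrow> col V j \<in> W" "\<And>w. w \<in> W \<Longrightarrow> V *\<^sub>v (ctranspose V *\<^sub>v w) = w"
    "\<And>g. g \<in> carrier G \<Longrightarrow> \<rho> g * V = V * (ctranspose V * \<rho> g * V)"
    "unitary_representation k (\<lambda>g. ctranspose V * \<rho> g * V)"
proof -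
  have sub: "VectorSpace.subspace class_ring W (module_vec TYPE(complex) n)"
    using W by (simp add: invariant_subspace_def)
  obtain k V where V: "V \<in> carrier_mat n k" and iso: "ctranspose V * V = 1\<^sub>m k"
    and cols: "\<And>j. j < k \<Longrightarrow> col V j \<in> W" and proj: "\<And>w. w \<in> W \<Longrightarrow> V *\<^sub>v (ctranspose V *\<^sub>v w) = w"
    by (rule subspace_isometry_exists[OF sub]) (rule that; assumption)
  have V': "ctranspose V \<in> carrier_mat k n" using V by simp
  have rep: "representation G n \<rho>" using \<rho> by (simp add: unitary_representation_def)
  note c = rep_carrier[OF rep]
  define \<sigma> where "\<sigma> g = ctranspose V * \<rho> g * V" for g
  have \<sigma>c: "\<sigma> g \<in> carrier_mat k k" if "g \<in> carrier G" for g
    unfolding \<sigma>_def by (rule mult_carrier_mat[OF mult_carrier_mat[OF V' c[OF that]] V])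
  have int: "\<rho> g * V = V * \<sigma> g" if g: "g \<in> carrier G" for g
  proof (rule eq_matI)
    \<comment> \<open>Compared column by column: each column of \<open>\<rho> g * V\<close> lies in
      \<open>W\<close>, where the projection acts as the identity.\<close>
    fix i j assume "i < dim_row (V * \<sigma> g)" "j < dim_col (V * \<sigma> g)"
    then have ij: "i < n" "j < k" using V \<sigma>c[OF g] by auto
    define w where "w = \<rho> g *\<^sub>v col V j"
    have w: "w \<in> W" using W cols[OF ij(2)] g by (auto simp: w_def invariant_subspace_def)
    have col: "col (\<rho> g * V) j = w" using col_mult2[OF c[OF g] V ij(2)] by (simp add: w_def)
    have \<sigma>': "\<sigma> g = ctranspose V * (\<rho> g * V)" unfolding \<sigma>_def by (rule assoc_mult_mat[OF V' c[OF g] V])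
    have gV: "\<rho> g * V \<in> carrier_mat n k" using c[OF g] V by simp
    have "col (V * \<sigma> g) j = V *\<^sub>v col (\<sigma> g) j" by (rule col_mult2[OF V \<sigma>c[OF g] ij(2)])
    also have "col (\<sigma> g) j = ctranspose V *\<^sub>v w"
      unfolding \<sigma>' col_mult2[OF V' gV ij(2)] col ..
    also have "V *\<^sub>v (ctranspose V *\<^sub>v w) = w" by (rule proj[OF w])
    finally have "col (\<rho> g * V) j = col (V * \<sigma> g) j" using col by simp
    then have "col (\<rho> g * V) j $ i = col (V * \<sigma> g) j $ i" by simp
    then show "(\<rho> g * V) $$ (i,j) = (V * \<sigma> g) $$ (i,j)"
      using ij V c[OF g] \<sigma>c[OF g] by (subst (asm) (1 2) index_col) auto
  qed (use V c[OF g] \<sigma>c[OF g] in auto)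
  have "unitary_representation k \<sigma>"
    unfolding unitary_representation_def representation_iff
  proof (intro conjI ballI)
    show "\<sigma> \<one> = 1\<^sub>m k" using iso by (simp add: \<sigma>_def rep_one[OF rep] right_mult_one_mat[OF V'])
    fix g assume g: "g \<in> carrier G"
    show "\<sigma> g \<in> carrier_mat k k" by (rule \<sigma>c[OF g])
    have "\<sigma> (inv g) = ctranspose V * (ctranspose (\<rho> g) * V)"
      using \<rho> g assoc_mult_mat[OF V' ctranspose_carrier[OF c[OF g]] V]
      by (simp add: \<sigma>_def unitary_representation_def)
    also have "\<dots> = ctranspose (\<sigma> g)"
      by (simp add: \<sigma>_def ctranspose_mult[OF mult_carrier_mat[OF V' c[OF g]] V]
          ctranspose_mult[OF V' c[OF g]])
    finally show "\<sigma> (inv g) = ctranspose (\<sigma> g)" .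
    fix h assume h: "h \<in> carrier G"
    have "\<sigma> (g \<otimes> h) = ctranspose V * (\<rho> g * \<rho> h) * V" using g h by (simp add: \<sigma>_def rep_mult[OF rep])
    also have "\<dots> = ctranspose V * \<rho> g * (\<rho> h * V)"
      by (simp only: assoc_mult_mat[OF V' mult_carrier_mat[OF c[OF g] c[OF h]] V]
          assoc_mult_mat[OF c[OF g] c[OF h] V] assoc_mult_mat[OF V' c[OF g] mult_carrier_mat[OF c[OF h] V]])
    also have "\<dots> = ctranspose V * \<rho> g * V * \<sigma> h"
      unfolding int[OF h] by (rule assoc_mult_mat[OF mult_carrier_mat[OF V' c[OF g]] V \<sigma>c[OF h], symmetric])
    finally show "\<sigma> (g \<otimes> h) = \<sigma> g * \<sigma> h" by (simp add: \<sigma>_def)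
  qed
  then have "unitary_representation k (\<lambda>g. ctranspose V * \<rho> g * V)" by (simp add: \<sigma>_def[abs_def])
  with V iso cols proj int[unfolded \<sigma>_def] show ?thesis by (rule that)
qed

text \<open>The restriction to a proper subspace has smaller degree, so the induction hypothesis
  applies to it; with \<open>w = V u\<close>, the sum is a combination of its annihilated
  coefficients.\<close>

lemma annihilates_on_subspace:
  assumes \<rho>: "unitary_representation n \<rho>" and W: "invariant_subspace G n \<rho> W"
    and proper: "W \<noteq> carrier_vec n"
    and IH: "\<And>m \<sigma>. m < n \<Longrightarrow> unitary_representation m \<sigma> \<Longrightarrow> annihilates f m \<sigma>"
    and w: "w \<in> W" and i: "i < n"
  shows "(\<Sum>g\<in>carrier G. f g * (\<rho> g *\<^sub>v w) $ i) = 0"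
proof -
  have rep: "representation G n \<rho>" using \<rho> by (simp add: unitary_representation_def)
  have wc: "w \<in> carrier_vec n" and sub: "VectorSpace.subspace class_ring W (module_vec TYPE(complex) n)"
    using w W by (auto simp: invariant_subspace_def subspace_module_vec_iff)
  obtain k V where V: "V \<in> carrier_mat n k" and iso: "ctranspose V * V = 1\<^sub>m k"
    and cols: "\<And>j. j < k \<Longrightarrow> col V j \<in> W" and proj: "\<And>w. w \<in> W \<Longrightarrow> V *\<^sub>v (ctranspose V *\<^sub>v w) = w"
    and int: "\<And>g. g \<in> carrier G \<Longrightarrow> \<rho> g * V = V * (ctranspose V * \<rho> g * V)"
    and uni: "unitary_representation k (\<lambda>g. ctranspose V * \<rho> g * V)"
    by (rule unitary_subrepresentation[OF \<rho> W]) (rule that; assumption)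
  have V': "ctranspose V \<in> carrier_mat k n" using V by simp
  \<comment> \<open>A square isometry is invertible, so its columns would span the whole space,
    contrary to \<open>proper\<close>.\<close>
  have "k \<noteq> n"
  proof
    assume k: "k = n"
    have VV: "V * ctranspose V = 1\<^sub>m n"
      using mat_mult_left_right_inverse[of "ctranspose V" n V] V iso k by auto
    have "v \<in> W" if v: "v \<in> carrier_vec n" for v
    proof -
      have u: "ctranspose V *\<^sub>v v \<in> carrier_vec k" by (rule mult_mat_vec_carrier[OF V' v])
      have "V *\<^sub>v (ctranspose V *\<^sub>v v) = v" using VV v V V'
        by (simp flip: assoc_mult_mat_vec[OF V V' v])
      then show ?thesis using subspace_mat_mult_vec[OF sub V cols u] by simp
    qed
    then show False using proper sub by (auto simp: subspace_module_vec_iff)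
  qed
  then have "k < n" using isometry_dim_le[OF V iso] by simp
  define \<sigma> where "\<sigma> g = ctranspose V * \<rho> g * V" for g
  have \<sigma>: "unitary_representation k \<sigma>" "\<And>g. g \<in> carrier G \<Longrightarrow> \<rho> g * V = V * \<sigma> g"
    using uni int by (auto simp: \<sigma>_def[abs_def])
  then have \<sigma>c: "\<sigma> g \<in> carrier_mat k k" if "g \<in> carrier G" for g
    using rep_carrier that by (auto simp: unitary_representation_def)
  have ann: "(\<Sum>g\<in>carrier G. f g * \<sigma> g $$ (a,b)) = 0" if "a < k" "b < k" for a b
    using IH[OF \<open>k < n\<close> \<sigma>(1)] that by (simp add: annihilates_def)
  define u where "u = ctranspose V *\<^sub>v w"
  have u: "u \<in> carrier_vec k" unfolding u_def by (rule mult_mat_vec_carrier[OF V' wc])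
  have entry: "(\<rho> g *\<^sub>v w) $ i = (\<Sum>a<k. \<Sum>b<k. V $$ (i,a) * (\<sigma> g $$ (a,b) * u $ b))"
    if g: "g \<in> carrier G" for g
  proof -
    have "\<rho> g *\<^sub>v w = \<rho> g *\<^sub>v (V *\<^sub>v u)" using proj[OF w] by (simp add: u_def)
    also have "\<dots> = V *\<^sub>v (\<sigma> g *\<^sub>v u)"
      by (simp only: \<sigma>(2)[OF g] flip: assoc_mult_mat_vec[OF rep_carrier[OF rep g] V u]
          assoc_mult_mat_vec[OF V \<sigma>c[OF g] u])
    finally show ?thesis using i
      by (simp add: index_mult_mat_vec_sum[OF V mult_mat_vec_carrier[OF \<sigma>c[OF g] u]]
          index_mult_mat_vec_sum[OF \<sigma>c[OF g] u] sum_distrib_left)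
  qed
  have "(\<Sum>g\<in>carrier G. f g * (\<rho> g *\<^sub>v w) $ i)
      = (\<Sum>g\<in>carrier G. \<Sum>a<k. \<Sum>b<k. V $$ (i,a) * u $ b * (f g * \<sigma> g $$ (a,b)))"
    by (simp add: entry sum_distrib_left mult_ac)
  also have "\<dots> = (\<Sum>a<k. \<Sum>b<k. V $$ (i,a) * u $ b * (\<Sum>g\<in>carrier G. f g * \<sigma> g $$ (a,b)))"
    unfolding sum_distrib_left by (subst sum.swap, intro sum.cong refl, subst sum.swap, rule refl)
  also have "\<dots> = 0" by (simp add: ann)
  finally show ?thesis .
qed

text \<open>The set is the orthogonal complement of the column span of \<open>V\<close>. By
  unitarity, moving \<open>\<rho> g\<close> across the inner product yields
  \<open>\<rho> (inv g)\<close>, which preserves that span.\<close>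

lemma orthogonal_complement_invariant:
  assumes \<rho>: "unitary_representation n \<rho>" and V: "V \<in> carrier_mat n k"
    and int: "\<And>g. g \<in> carrier G \<Longrightarrow> \<exists>S\<in>carrier_mat k k. \<rho> g * V = V * S"
  shows "invariant_subspace G n \<rho> {v \<in> carrier_vec n. ctranspose V *\<^sub>v v = 0\<^sub>v k}"
proof -
  have rep: "representation G n \<rho>" using \<rho> by (simp add: unitary_representation_def)
  have V': "ctranspose V \<in> carrier_mat k n" using V by simp
  show ?thesis
    unfolding invariant_subspace_def subspace_module_vec_iff
  proof (intro conjI ballI allI)
    fix g w assume g: "g \<in> carrier G" and "w \<in> {v \<in> carrier_vec n. ctranspose V *\<^sub>v v = 0\<^sub>v k}"
    then have w: "w \<in> carrier_vec n" "ctranspose V *\<^sub>v w = 0\<^sub>v k" by auto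
    obtain S where S: "S \<in> carrier_mat k k" "\<rho> (inv g) * V = V * S" using int[of "inv g"] g by auto
    have c: "\<rho> g \<in> carrier_mat n n" "\<rho> (inv g) \<in> carrier_mat n n" using rep_carrier[OF rep] g by auto
    have "ctranspose V * \<rho> g = ctranspose (\<rho> (inv g) * V)"
      unfolding ctranspose_mult[OF c(2) V] using \<rho> g by (simp add: unitary_representation_def)
    also have "\<dots> = ctranspose S * ctranspose V" by (simp add: S(2) ctranspose_mult[OF V S(1)])
    finally have eq: "ctranspose V * \<rho> g = ctranspose S * ctranspose V" .
    have "ctranspose V *\<^sub>v (\<rho> g *\<^sub>v w) = ctranspose S *\<^sub>v (ctranspose V *\<^sub>v w)"
      by (simp only: eq flip: assoc_mult_mat_vec[OF V' c(1) w(1)]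
          assoc_mult_mat_vec[OF ctranspose_carrier[OF S(1)] V' w(1)])
    also have "\<dots> = 0\<^sub>v k" using w(2) mult_mat_zero_vec[OF ctranspose_carrier[OF S(1)]] by simp
    finally show "\<rho> g *\<^sub>v w \<in> {v \<in> carrier_vec n. ctranspose V *\<^sub>v v = 0\<^sub>v k}"
      using mult_mat_vec_carrier[OF c(1) w(1)] by simp
  qed (auto simp: mult_mat_zero_vec[OF V'] mult_add_distrib_mat_vec[OF V'] mult_mat_vec[OF V'])
qed

text \<open>Complete reducibility, recast as induction on the degree: each unit vector splits into
  parts in a proper invariant subspace and in its orthogonal complement.\<close>

lemma annihilates_unitary:
  assumes irr: "\<And>m \<tau>. irreducible_representation G m \<tau> \<Longrightarrow> unitary_representation m \<tau> \<Longrightarrow> annihilates f m \<tau>"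
  shows "unitary_representation n \<rho> \<Longrightarrow> annihilates f n \<rho>"
proof (induction n arbitrary: \<rho> rule: less_induct)
  case (less n)
  note \<rho> = less.prems
  have rep: "representation G n \<rho>" using \<rho> by (simp add: unitary_representation_def)
  show ?case
  \<comment> \<open>Degree 0 is excluded from irreducibility but has no coefficients to
    annihilate.\<close>
  proof (cases "n = 0 \<or> irreducible_representation G n \<rho>")
    case True
    then show ?thesis using irr \<rho> by (auto simp: annihilates_def)
  next
    case False
    then obtain W where W: "invariant_subspace G n \<rho> W" "W \<noteq> {0\<^sub>v n}" "W \<noteq> carrier_vec n"
      using rep by (auto simp: irreducible_representation_def)
    obtain k V where V: "V \<in> carrier_mat n k" and iso: "ctranspose V * V = 1\<^sub>m k"
      and cols: "\<And>j. j < k \<Longrightarrow> col V j \<in> W" and proj: "\<And>w. w \<in> W \<Longrightarrow> V *\<^sub>v (ctranspose V *\<^sub>v w) = w"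
      and int: "\<And>g. g \<in> carrier G \<Longrightarrow> \<rho> g * V = V * (ctranspose V * \<rho> g * V)"
      and "unitary_representation k (\<lambda>g. ctranspose V * \<rho> g * V)"
      by (rule unitary_subrepresentation[OF \<rho> W(1)]) (rule that; assumption)
    have V': "ctranspose V \<in> carrier_mat k n" using V by simp
    have sub: "VectorSpace.subspace class_ring W (module_vec TYPE(complex) n)"
      using W by (simp add: invariant_subspace_def)
    define W' where "W' = {v \<in> carrier_vec n. ctranspose V *\<^sub>v v = 0\<^sub>v k}"
    have W': "invariant_subspace G n \<rho> W'" unfolding W'_def
    proof (rule orthogonal_complement_invariant[OF \<rho> V])
      fix g assume g: "g \<in> carrier G"
      have "ctranspose V * \<rho> g * V \<in> carrier_mat k k"
        by (rule mult_carrier_mat[OF mult_carrier_mat[OF V' rep_carrier[OF rep g]] V])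
      then show "\<exists>S\<in>carrier_mat k k. \<rho> g * V = V * S" using int[OF g] by blast
    qed
    have proper: "W' \<noteq> carrier_vec n"
    proof
      assume eq: "W' = carrier_vec n"
      have "w = 0\<^sub>v n" if "w \<in> W" for w
      proof -
        have "w \<in> W'" using that sub unfolding eq by (auto simp: subspace_module_vec_iff)
        then show ?thesis using proj[OF that] mult_mat_zero_vec[OF V] by (simp add: W'_def)
      qed
      then have "W = {0\<^sub>v n}" using sub by (auto simp: subspace_module_vec_iff)
      then show False using W(2) by simp
    qed
    show ?thesis unfolding annihilates_def
    proof (intro allI impI)
      fix i j assume ij: "i < n" "j < n"
      define v where "v = (unit_vec n j :: complex vec)"
      \<comment> \<open>The orthogonal projection of the unit vector onto \<open>W\<close>; the
        remainder \<open>v - w\<close> lies in \<open>W'\<close>.\<close>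
      define w where "w = V *\<^sub>v (ctranspose V *\<^sub>v v)"
      have v: "v \<in> carrier_vec n" by (simp add: v_def)
      have Vv: "ctranspose V *\<^sub>v v \<in> carrier_vec k" by (rule mult_mat_vec_carrier[OF V' v])
      have w: "w \<in> W" unfolding w_def by (rule subspace_mat_mult_vec[OF sub V cols Vv])
      then have wc: "w \<in> carrier_vec n" using sub by (auto simp: subspace_module_vec_iff)
      have "ctranspose V *\<^sub>v w = (ctranspose V * V) *\<^sub>v (ctranspose V *\<^sub>v v)"
        unfolding w_def by (rule assoc_mult_mat_vec[OF V' V Vv, symmetric])
      also have "\<dots> = ctranspose V *\<^sub>v v" using iso Vv by simp
      finally have "v - w \<in> W'" using v wc Vv
        by (simp add: W'_def mult_minus_distrib_mat_vec[OF V' v wc])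
      have "\<rho> g $$ (i,j) = (\<rho> g *\<^sub>v w) $ i + (\<rho> g *\<^sub>v (v - w)) $ i" if g: "g \<in> carrier G" for g
      proof -
        note c = rep_carrier[OF rep g]
        have "(\<rho> g *\<^sub>v w) $ i + (\<rho> g *\<^sub>v (v - w)) $ i = (\<rho> g *\<^sub>v w) $ i + ((\<rho> g *\<^sub>v v) $ i - (\<rho> g *\<^sub>v w) $ i)"
          using c ij by (simp add: mult_minus_distrib_mat_vec[OF c v wc])
        then show ?thesis using ij by (simp add: v_def index_mult_mat_unit_vec[OF c])
      qed
      then have "(\<Sum>g\<in>carrier G. f g * \<rho> g $$ (i,j)) = (\<Sum>g\<in>carrier G. f g * (\<rho> g *\<^sub>v w) $ i)
          + (\<Sum>g\<in>carrier G. f g * (\<rho> g *\<^sub>v (v - w)) $ i)"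
        by (simp add: distrib_left sum.distrib)
      also have "\<dots> = 0"
        using annihilates_on_subspace[OF \<rho> W(1,3) less.IH w ij(1)]
          annihilates_on_subspace[OF \<rho> W' proper less.IH \<open>v - w \<in> W'\<close> ij(1)] by simp
      finally show "(\<Sum>g\<in>carrier G. f g * \<rho> g $$ (i,j)) = 0" .
    qed
  qed
qed

text \<open>Applied to the regular representation, which is unitary, \<open>annihilates_unitary\<close> shows that the
  irreducible unitary representations separate the elements of the group algebra.\<close>

lemma unitary_irreps_separate:
  assumes irr: "\<And>m \<tau>. irreducible_representation G m \<tau> \<Longrightarrow> unitary_representation m \<tau> \<Longrightarrow> annihilates f m \<tau>"
    and g: "g \<in> carrier G"
  shows "f g = 0"
proof -
  define n where "n = card (carrier G)"
  obtain e where e: "bij_betw e {..<n} (carrier G)"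
    using ex_bij_betw_nat_finite[OF fin] by (auto simp: n_def lessThan_atLeast0)
  have ec: "e i \<in> carrier G" if "i < n" for i using e that by (auto simp: bij_betw_def)
  have einj: "e i = e j \<longleftrightarrow> i = j" if "i < n" "j < n" for i j
    using e that by (auto simp: bij_betw_def inj_on_def)
  \<comment> \<open>Permutation matrices of left translation in the enumeration \<open>e\<close>:
    the basis vector of \<open>e j\<close> goes to that of \<open>h \<otimes> e j\<close>.\<close>
  define L where "L h = mat n n (\<lambda>(i,j). if e i = h \<otimes> e j then 1 else 0 :: complex)" for h
  have "unitary_representation n L"
    unfolding unitary_representation_def representation_iff
  proof (intro conjI ballI)
    show "L \<one> = 1\<^sub>m n" by (rule eq_matI) (auto simp: L_def ec einj)
    fix h assume h: "h \<in> carrier G"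
    show Lc: "L h \<in> carrier_mat n n" by (simp add: L_def)
    have "e i = inv h \<otimes> e j \<longleftrightarrow> e j = h \<otimes> e i" if "i < n" "j < n" for i j
      using h ec that by (metis inv_solve_left)
    then show "L (inv h) = ctranspose (L h)"
      by (intro eq_matI) (auto simp: L_def ctranspose_def)
    fix h' assume h': "h' \<in> carrier G"
    have Lc': "L h' \<in> carrier_mat n n" by (simp add: L_def)
    show "L (h \<otimes> h') = L h * L h'"
    proof (rule eq_matI)
      fix i j assume "i < dim_row (L h * L h')" "j < dim_col (L h * L h')"
      then have ij: "i < n" "j < n" by (auto simp: L_def)
      have "h' \<otimes> e j \<in> e ` {..<n}" using h' ec[OF ij(2)] e by (simp add: bij_betw_def)
      then obtain k where k: "k < n" "e k = h' \<otimes> e j" by auto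
      have "(L h * L h') $$ (i,j) = (\<Sum>l<n. if l = k then (if e i = h \<otimes> e k then 1 else 0) else 0)"
        unfolding index_mult_mat_sum[OF Lc Lc' ij] using ij k
        by (intro sum.cong) (auto simp: L_def einj simp flip: k(2))
      also have "\<dots> = L (h \<otimes> h') $$ (i,j)"
        using ij k h h' ec by (simp add: L_def m_assoc)
      finally show "L (h \<otimes> h') $$ (i,j) = (L h * L h') $$ (i,j)" by simp
    qed (auto simp: L_def)
  qed
  then have ann: "annihilates f n L" using annihilates_unitary[OF irr] by blast
  have "g \<in> e ` {..<n}" "\<one> \<in> e ` {..<n}" using g e by (auto simp: bij_betw_def)
  \<comment> \<open>The entry of \<open>L h\<close> in row \<open>g\<close> and column
    \<open>\<one>\<close> is 1 for \<open>h = g\<close> alone, so this coefficient isolates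
    \<open>f g\<close>.\<close>
  then obtain i j where ij: "i < n" "j < n" "e i = g" "e j = \<one>" by auto
  have "0 = (\<Sum>h\<in>carrier G. f h * L h $$ (i,j))" using ann ij by (simp add: annihilates_def)
  also have "\<dots> = (\<Sum>h\<in>carrier G. if h = g then f g else 0)"
    using ij by (intro sum.cong) (auto simp: L_def)
  also have "\<dots> = f g" using g fin by simp
  finally show ?thesis by simp
qed

lemma irrep_equivalent_unitary:
  assumes \<rho>: "irreducible_representation G n \<rho>"
  obtains \<tau> where "irreducible_representation G n \<tau>" "unitary_representation n \<tau>"
    "equivalent_representations G \<rho> \<tau>"
proof (rule ccontr)
  assume no: "\<not> thesis"
  have rep: "representation G n \<rho>" and n: "n > 0" using \<rho> by (auto simp: irreducible_representation_def)
  \<comment> \<open>The inverse is there because orthogonality pairs values at \<open>g\<close> and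
    \<open>inv g\<close>. Assuming no equivalent unitary representation, \<open>f\<close> is
    annihilated by all of them, while \<open>f \<one>\<close> is a diagonal entry of the unit
    matrix.\<close>
  define f where "f g = \<rho> (inv g) $$ (0,0)" for g
  have "f \<one> = 0"
  proof (rule unitary_irreps_separate)
    fix m \<tau> assume \<tau>: "irreducible_representation G m \<tau>" "unitary_representation m \<tau>"
    have "\<not> equivalent_representations G \<rho> \<tau>"
    proof
      assume eq: "equivalent_representations G \<rho> \<tau>"
      have "representation G m \<tau>" using \<tau> by (simp add: irreducible_representation_def)
      then have "m = n" using equivalent_representations_degree[OF eq] rep_degree_eq rep by metis
      then show False using no that \<tau> eq by blast
    qed
    then show "annihilates f m \<tau>"
      using schur_orthogonality_inequivalent[OF \<tau>(1) \<rho>] n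
      by (auto simp: annihilates_def f_def mult.commute)
  qed simp
  then show False using n by (simp add: f_def rep_one[OF rep])
qed

section \<open>Complete systems of matrix coefficients\<close>

lemma sum_factorizations:
  assumes c: "c \<in> carrier G"
  shows "(\<Sum>(x, y) | x \<in> carrier G \<and> y \<in> carrier G \<and> x \<otimes> y = c. F x y)
    = (\<Sum>x\<in>carrier G. F x (inv x \<otimes> c))"
  by (rule sum.reindex_bij_witness[of _ "\<lambda>x. (x, inv x \<otimes> c)" fst])
     (use c in \<open>auto simp flip: m_assoc\<close>)

text \<open>For \<open>F x y\<close> of the form \<open>f x * f' y\<close> the inner sum is the
  convolution of \<open>f\<close> and \<open>f'\<close>, and the formula evaluates a linear
  functional on a product in the group algebra.\<close>

lemma sum_convolution:
  "(\<Sum>c\<in>carrier G. (\<Sum>(x, y) | x \<in> carrier G \<and> y \<in> carrier G \<and> x \<otimes> y = c. F x y) * h c)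
    = (\<Sum>x\<in>carrier G. \<Sum>y\<in>carrier G. F x y * (h (x \<otimes> y) :: complex))"
proof -
  have "(\<Sum>c\<in>carrier G. (\<Sum>(x, y) | x \<in> carrier G \<and> y \<in> carrier G \<and> x \<otimes> y = c. F x y) * h c)
      = (\<Sum>x\<in>carrier G. \<Sum>c\<in>carrier G. F x (inv x \<otimes> c) * h c)"
    by (subst sum.swap) (simp add: sum_factorizations sum_distrib_right)
  also have "\<dots> = (\<Sum>x\<in>carrier G. \<Sum>y\<in>carrier G. F x y * h (x \<otimes> y))"
  proof (rule sum.cong[OF refl])
    fix x assume x: "x \<in> carrier G"
    show "(\<Sum>c\<in>carrier G. F x (inv x \<otimes> c) * h c) = (\<Sum>y\<in>carrier G. F x y * h (x \<otimes> y))"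
      using x sum_translate[OF x, of "\<lambda>c. F x (inv x \<otimes> c) * h c"] by (simp flip: m_assoc)
  qed
  finally show ?thesis .
qed

text \<open>Bessel's inequality for the Dirac function at the identity bounds the size of the family.\<close>

lemma finite_orthogonal_family:
  fixes e :: "'i \<Rightarrow> 'a \<Rightarrow> complex" and d :: "'i \<Rightarrow> nat"
  assumes one: "\<And>i. i \<in> I \<Longrightarrow> e i \<one> = 1" and dpos: "\<And>i. i \<in> I \<Longrightarrow> d i > 0"
    and star: "\<And>i g. i \<in> I \<Longrightarrow> g \<in> carrier G \<Longrightarrow> e i (inv g) = cnj (e i g)"
    and orth: "\<And>i j. i \<in> I \<Longrightarrow> j \<in> I \<Longrightarrow>
      (\<Sum>g\<in>carrier G. e i g * e j (inv g)) = (if i = j then N / of_nat (d i) else 0)"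
  shows "finite I"
proof (rule ccontr)
  assume "infinite I"
  then obtain S where S: "S \<subseteq> I" "finite S" "card S = Suc (card (carrier G))"
    by (meson infinite_arbitrarily_large)
  \<comment> \<open>The orthogonal projection of the Dirac function onto the span of the chosen
    functions: its inner product with \<open>e i\<close> is 1, and the squared norm of
    \<open>e i\<close> is \<open>N / d i\<close>.\<close>
  define A where "A g = (\<Sum>i\<in>S. of_nat (d i) / N * e i g)" for g
  define \<delta> where "\<delta> g = (if g = \<one> then 1 else 0 :: complex)" for g
  define s where "s = (\<Sum>i\<in>S. of_nat (d i) / N)"
  have A1: "A \<one> = s" using S by (auto simp: A_def s_def one intro!: sum.cong)
  have Astar: "cnj (A g) = A (inv g)" if "g \<in> carrier G" for g
    using S star that unfolding A_def cnj_sum by (intro sum.cong) auto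
  have "(\<Sum>g\<in>carrier G. A g * A (inv g))
      = (\<Sum>g\<in>carrier G. \<Sum>i\<in>S. \<Sum>j\<in>S. of_nat (d i) / N * (of_nat (d j) / N) * (e i g * e j (inv g)))"
    by (simp add: A_def sum_product mult_ac)
  also have "\<dots> = (\<Sum>i\<in>S. \<Sum>j\<in>S. of_nat (d i) / N * (of_nat (d j) / N) * (\<Sum>g\<in>carrier G. e i g * e j (inv g)))"
    unfolding sum_distrib_left sum.swap[of _ S "carrier G"] ..
  also have "\<dots> = (\<Sum>i\<in>S. \<Sum>j\<in>S. if j = i then of_nat (d i) / N else 0)"
    using S dpos card_carrier_nonzero by (intro sum.cong) (auto simp: orth subset_iff)
  also have "\<dots> = s" using S by (simp add: s_def)
  finally have AA: "(\<Sum>g\<in>carrier G. A g * A (inv g)) = s" .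
  have \<delta>: "(\<Sum>g\<in>carrier G. \<delta> g * h g) = h \<one>" for h :: "'a \<Rightarrow> complex"
    using fin by (simp add: \<delta>_def if_distrib[of "\<lambda>x. x * _"] cong: if_cong)
  have "complex_of_real (\<Sum>g\<in>carrier G. (cmod (\<delta> g - A g))\<^sup>2)
      = (\<Sum>g\<in>carrier G. (\<delta> g - A g) * cnj (\<delta> g - A g))"
    by (simp only: of_real_sum complex_norm_square)
  also have "\<dots> = (\<Sum>g\<in>carrier G. \<delta> g * \<delta> g - \<delta> g * A (inv g) - \<delta> g * A g + A g * A (inv g))"
    by (intro sum.cong refl) (simp add: Astar algebra_simps, simp add: \<delta>_def)
  also have "\<dots> = 1 - s"
    using A1 by (simp add: sum.distrib sum_subtractf \<delta> AA) (simp add: \<delta>_def)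
  finally have "complex_of_real (\<Sum>g\<in>carrier G. (cmod (\<delta> g - A g))\<^sup>2) = 1 - s" .
  moreover have "s = complex_of_real ((\<Sum>i\<in>S. real (d i)) / card (carrier G))"
    by (simp add: s_def sum_divide_distrib)
  ultimately have "complex_of_real (\<Sum>g\<in>carrier G. (cmod (\<delta> g - A g))\<^sup>2)
      = complex_of_real (1 - (\<Sum>i\<in>S. real (d i)) / card (carrier G))" by simp
  then have "(\<Sum>g\<in>carrier G. (cmod (\<delta> g - A g))\<^sup>2) = 1 - (\<Sum>i\<in>S. real (d i)) / card (carrier G)"
    by (simp only: of_real_eq_iff)
  moreover have "(\<Sum>g\<in>carrier G. (cmod (\<delta> g - A g))\<^sup>2) \<ge> 0" by (intro sum_nonneg) simp
  \<comment> \<open>So the degrees in \<open>S\<close> add up to at most the group order, although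
    \<open>S\<close> has one element more and each degree is at least 1.\<close>
  ultimately have "(\<Sum>i\<in>S. real (d i)) / card (carrier G) \<le> 1" by linarith
  then have "(\<Sum>i\<in>S. real (d i)) \<le> card (carrier G)"
    using card_carrier_nonzero by (simp add: divide_le_eq)
  moreover have "(\<Sum>i\<in>S. 1) \<le> (\<Sum>i\<in>S. real (d i))"
    using S dpos by (intro sum_mono) (metis One_nat_def Suc_leI of_nat_1 of_nat_mono subsetD)
  ultimately show False using S by simp
qed

end

text \<open>The scalar content of one unitary representative per class, \<open>r i g p q\<close>
  being the entry \<open>(p,q)\<close> at \<open>g\<close>. Keeping the index set abstract lets two
  groups share it.\<close>

locale complete_system = finite_group G for G :: "('a, 'm) monoid_scheme" (structure) +
  fixes I :: "'i set" and d :: "'i \<Rightarrow> nat" and r :: "'i \<Rightarrow> 'a \<Rightarrow> nat \<Rightarrow> nat \<Rightarrow> complex"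
  assumes finite_index: "finite I"
    and degree_pos: "i \<in> I \<Longrightarrow> d i > 0"
    and coeff_one: "i \<in> I \<Longrightarrow> p < d i \<Longrightarrow> q < d i \<Longrightarrow> r i \<one> p q = (if p = q then 1 else 0)"
    and coeff_mult: "i \<in> I \<Longrightarrow> p < d i \<Longrightarrow> q < d i \<Longrightarrow> g \<in> carrier G \<Longrightarrow> h \<in> carrier G \<Longrightarrow>
      r i (g \<otimes> h) p q = (\<Sum>k<d i. r i g p k * r i h k q)"
    and coeff_inv: "i \<in> I \<Longrightarrow> p < d i \<Longrightarrow> q < d i \<Longrightarrow> g \<in> carrier G \<Longrightarrow> r i (inv g) p q = cnj (r i g q p)"
    and coeff_orthogonal: "i \<in> I \<Longrightarrow> j \<in> I \<Longrightarrow> p < d i \<Longrightarrow> q < d i \<Longrightarrow> k < d j \<Longrightarrow> l < d j \<Longrightarrow>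
      (\<Sum>g\<in>carrier G. r i g p q * r j (inv g) k l) = (if i = j \<and> p = l \<and> q = k then N / of_nat (d i) else 0)"
    and coeff_separate: "(\<And>i p q. i \<in> I \<Longrightarrow> p < d i \<Longrightarrow> q < d i \<Longrightarrow> (\<Sum>g\<in>carrier G. f g * r i g p q) = 0) \<Longrightarrow>
      g \<in> carrier G \<Longrightarrow> f g = 0"
begin

lemma coeff_separate_eq:
  assumes "\<And>i p q. i \<in> I \<Longrightarrow> p < d i \<Longrightarrow> q < d i \<Longrightarrow>
      (\<Sum>g\<in>carrier G. f g * r i g p q) = (\<Sum>g\<in>carrier G. f' g * r i g p q)"
    and "g \<in> carrier G"
  shows "f g = f' g"
proof -
  have "f g - f' g = 0"
    by (rule coeff_separate[where f = "\<lambda>g. f g - f' g"])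
       (use assms in \<open>auto simp: left_diff_distrib sum_subtractf\<close>)
  then show ?thesis by simp
qed

text \<open>By orthogonality both sides, after inverting \<open>g\<close>, have the same sums
  against every coefficient, so they agree by separation.\<close>

lemma regular_character:
  assumes g: "g \<in> carrier G"
  shows "(\<Sum>i\<in>I. of_nat (d i) * (\<Sum>p<d i. r i g p p)) = (if g = \<one> then N else 0)"
proof -
  define K where "K g = (\<Sum>i\<in>I. of_nat (d i) * (\<Sum>p<d i. r i g p p))" for g
  have "K (inv (inv g)) = (if inv g = \<one> then N else 0)"
  proof (rule coeff_separate_eq[where f = "\<lambda>g. K (inv g)" and f' = "\<lambda>g. if g = \<one> then N else 0"])
    fix i p q assume i: "i \<in> I" "p < d i" "q < d i"
    have "(\<Sum>g\<in>carrier G. K (inv g) * r i g p q)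
        = (\<Sum>g\<in>carrier G. \<Sum>j\<in>I. \<Sum>k<d j. of_nat (d j) * (r i g p q * r j (inv g) k k))"
      by (simp add: K_def sum_distrib_left sum_distrib_right mult_ac)
    also have "\<dots> = (\<Sum>j\<in>I. \<Sum>k<d j. of_nat (d j) * (\<Sum>g\<in>carrier G. r i g p q * r j (inv g) k k))"
      unfolding sum_distrib_left by (subst sum.swap, intro sum.cong refl, subst sum.swap, rule refl)
    \<comment> \<open>The factor \<open>d j\<close> cancels the denominator in the orthogonality
      relation, leaving \<open>N\<close>.\<close>
    also have "\<dots> = (\<Sum>j\<in>I. \<Sum>k<d j. if k = p then if j = i then if p = q then N else 0 else 0 else 0)"
      using i degree_pos[OF i(1)] by (intro sum.cong refl) (auto simp: coeff_orthogonal)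
    also have "\<dots> = (\<Sum>j\<in>I. if j = i then if p = q then N else 0 else 0)"
      using i by (intro sum.cong refl) auto
    also have "\<dots> = (if p = q then N else 0)"
      using i finite_index by simp
    also have "\<dots> = (\<Sum>g\<in>carrier G. if g = \<one> then N * r i \<one> p q else 0)"
      using i fin by (simp add: coeff_one)
    also have "\<dots> = (\<Sum>g\<in>carrier G. (if g = \<one> then N else 0) * r i g p q)"
      by (intro sum.cong) auto
    finally show "(\<Sum>g\<in>carrier G. K (inv g) * r i g p q)
        = (\<Sum>g\<in>carrier G. (if g = \<one> then N else 0) * r i g p q)" .
  qed (use g in auto)
  then show ?thesis using g by (simp add: K_def)
qed

lemma sum_degree_squares: "(\<Sum>i\<in>I. d i * d i) = card (carrier G)"
proof -
  have "(of_nat (\<Sum>i\<in>I. d i * d i) :: complex) = (\<Sum>i\<in>I. of_nat (d i) * (\<Sum>p<d i. r i \<one> p p))"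
    by (simp add: coeff_one)
  also have "\<dots> = N" by (simp add: regular_character)
  finally show ?thesis by (simp only: of_nat_eq_iff)
qed

end

section \<open>The transformation matrix of two systems with the same degrees\<close>

text \<open>The composition of the Fourier transform of \<open>G\<close> with the inverse Fourier transform of \<open>H\<close>.\<close>

definition fourier_change ::
    "('b, 'n) monoid_scheme \<Rightarrow> 'i set \<Rightarrow> ('i \<Rightarrow> nat) \<Rightarrow> ('i \<Rightarrow> 'a \<Rightarrow> nat \<Rightarrow> nat \<Rightarrow> complex) \<Rightarrow>
      ('i \<Rightarrow> 'b \<Rightarrow> nat \<Rightarrow> nat \<Rightarrow> complex) \<Rightarrow> 'a \<Rightarrow> 'b \<Rightarrow> complex" where
  "fourier_change H I d r s a x =
     (\<Sum>i\<in>I. of_nat (d i) * (\<Sum>p<d i. \<Sum>q<d i. r i a p q * s i (inv\<^bsub>H\<^esub> x) q p)) / of_nat (card (carrier H))"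

text \<open>Common \<open>I\<close> and \<open>d\<close> encode the matching of the classes along
  equal degrees.\<close>

locale complete_system_pair = G: complete_system G I d r + H: complete_system H I d s
  for G :: "('a, 'm) monoid_scheme" and H :: "('b, 'n) monoid_scheme" and I :: "'i set" and d r s
begin

definition U where "U = fourier_change H I d r s"

lemma card_eq: "card (carrier G) = card (carrier H)"
  using G.sum_degree_squares H.sum_degree_squares by simp

text \<open>Characterises the row of \<open>a\<close> by its Fourier transform on \<open>H\<close>:
  orthogonality on \<open>H\<close> leaves a single term, whose weight cancels.\<close>

lemma transform_U:
  assumes a: "a \<in> carrier G" and j: "j \<in> I" "k < d j" "l < d j"
  shows "(\<Sum>x\<in>carrier H. U a x * s j x k l) = r j a k l"
proof -
  have "(\<Sum>x\<in>carrier H. U a x * s j x k l)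
      = (\<Sum>x\<in>carrier H. \<Sum>i\<in>I. \<Sum>p<d i. \<Sum>q<d i. of_nat (d i) / H.N * r i a p q * (s j x k l * s i (inv\<^bsub>H\<^esub> x) q p))"
    by (simp add: U_def fourier_change_def sum_divide_distrib sum_distrib_left sum_distrib_right mult_ac)
  also have "\<dots> = (\<Sum>i\<in>I. \<Sum>p<d i. \<Sum>q<d i. of_nat (d i) / H.N * r i a p q *
      (\<Sum>x\<in>carrier H. s j x k l * s i (inv\<^bsub>H\<^esub> x) q p))"
    unfolding sum_distrib_left
    by (subst sum.swap, intro sum.cong refl, subst sum.swap, intro sum.cong refl, subst sum.swap, rule refl)
  also have "\<dots> = (\<Sum>i\<in>I. \<Sum>p<d i. \<Sum>q<d i. if q = l then if p = k then if i = j then r j a k l else 0 else 0 else 0)"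
    using j G.degree_pos[OF j(1)] H.card_carrier_nonzero
    by (intro sum.cong refl) (auto simp: H.coeff_orthogonal)
  also have "\<dots> = (\<Sum>i\<in>I. \<Sum>p<d i. if p = k then if i = j then r j a k l else 0 else 0)"
    using j by (intro sum.cong refl) auto
  also have "\<dots> = (\<Sum>i\<in>I. if i = j then r j a k l else 0)"
    using j by (intro sum.cong refl) auto
  also have "\<dots> = r j a k l" using j G.finite_index by simp
  finally show ?thesis .
qed

text \<open>As functions of \<open>c\<close>, both sides have the transform
  \<open>r i (a b)\<close>: a convolution is transformed into a matrix product. Separation then
  gives equality.\<close>

lemma U_mult:
  assumes a: "a \<in> carrier G" and b: "b \<in> carrier G" and c: "c \<in> carrier H"
  shows "U (a \<otimes>\<^bsub>G\<^esub> b) c = (\<Sum>(x, y) | x \<in> carrier H \<and> y \<in> carrier H \<and> x \<otimes>\<^bsub>H\<^esub> y = c. U a x * U b y)"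
proof (rule H.coeff_separate_eq[where f = "U (a \<otimes>\<^bsub>G\<^esub> b)"])
  fix i p q assume i: "i \<in> I" "p < d i" "q < d i"
  have "(\<Sum>c\<in>carrier H. (\<Sum>(x, y) | x \<in> carrier H \<and> y \<in> carrier H \<and> x \<otimes>\<^bsub>H\<^esub> y = c. U a x * U b y) * s i c p q)
      = (\<Sum>x\<in>carrier H. \<Sum>y\<in>carrier H. U a x * U b y * s i (x \<otimes>\<^bsub>H\<^esub> y) p q)"
    by (rule H.sum_convolution)
  also have "\<dots> = (\<Sum>x\<in>carrier H. \<Sum>y\<in>carrier H. \<Sum>k<d i. (U a x * s i x p k) * (U b y * s i y k q))"
    using i by (simp add: H.coeff_mult sum_distrib_left mult_ac)
  also have "\<dots> = (\<Sum>k<d i. (\<Sum>x\<in>carrier H. U a x * s i x p k) * (\<Sum>y\<in>carrier H. U b y * s i y k q))"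
    unfolding sum_product sum.swap[of _ "carrier H" "{..<d i}"] ..
  also have "\<dots> = r i (a \<otimes>\<^bsub>G\<^esub> b) p q" using a b i by (simp add: transform_U G.coeff_mult)
  finally show "(\<Sum>c\<in>carrier H. U (a \<otimes>\<^bsub>G\<^esub> b) c * s i c p q)
      = (\<Sum>c\<in>carrier H. (\<Sum>(x, y) | x \<in> carrier H \<and> y \<in> carrier H \<and> x \<otimes>\<^bsub>H\<^esub> y = c. U a x * U b y) * s i c p q)"
    using a b i by (simp add: transform_U)
qed (rule c)

text \<open>Conjugation inverts the argument and transposes the indices in both factors; swapping
  the two index sums undoes the transposition.\<close>

lemma U_inv:
  assumes "a \<in> carrier G" "x \<in> carrier H"
  shows "cnj (U a x) = U (inv\<^bsub>G\<^esub> a) (inv\<^bsub>H\<^esub> x)"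
proof -
  have "cnj (U a x) = (\<Sum>i\<in>I. of_nat (d i) * (\<Sum>p<d i. \<Sum>q<d i. r i (inv\<^bsub>G\<^esub> a) q p * s i x p q)) / H.N"
    using assms
    by (auto simp: U_def fourier_change_def H.coeff_inv G.coeff_inv intro!: sum.cong arg_cong2[of _ _ _ _ "(*)"])
  also have "\<dots> = U (inv\<^bsub>G\<^esub> a) (inv\<^bsub>H\<^esub> x)"
    using assms unfolding U_def fourier_change_def by (subst sum.swap) simp
  finally show ?thesis .
qed

text \<open>At the identity of \<open>H\<close> the second factor is a unit matrix, which leaves the
  regular character of \<open>G\<close>.\<close>

lemma U_one:
  assumes a: "a \<in> carrier G"
  shows "U a \<one>\<^bsub>H\<^esub> = (if a = \<one>\<^bsub>G\<^esub> then 1 else 0)"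
proof -
  have "U a \<one>\<^bsub>H\<^esub> = (\<Sum>i\<in>I. of_nat (d i) * (\<Sum>p<d i. r i a p p)) / H.N"
    unfolding U_def fourier_change_def
    by (auto simp: H.coeff_one if_distrib[of "\<lambda>x. _ * x"] cong: if_cong
        intro!: sum.cong arg_cong2[of _ _ _ _ "(*)"])
  then show ?thesis using a H.card_carrier_nonzero by (simp add: G.regular_character card_eq)
qed

lemma U_rows:
  assumes a: "a \<in> carrier G" and a': "a' \<in> carrier G"
  shows "(\<Sum>x\<in>carrier H. U a x * cnj (U a' x)) = (if a = a' then 1 else 0)"
proof -
  \<comment> \<open>The trailing unit exhibits the sum as a convolution at the identity, so that
    multiplicativity can be read backwards.\<close>
  have "(\<Sum>x\<in>carrier H. U a x * cnj (U a' x)) = (\<Sum>x\<in>carrier H. U a x * U (inv\<^bsub>G\<^esub> a') (inv\<^bsub>H\<^esub> x \<otimes>\<^bsub>H\<^esub> \<one>\<^bsub>H\<^esub>))"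
    using a' by (simp add: U_inv)
  also have "\<dots> = U (a \<otimes>\<^bsub>G\<^esub> inv\<^bsub>G\<^esub> a') \<one>\<^bsub>H\<^esub>"
    using a a' by (simp only: U_mult G.inv_closed H.one_closed H.sum_factorizations)
  also have "\<dots> = (if a = a' then 1 else 0)"
  proof -
    have "a \<otimes>\<^bsub>G\<^esub> inv\<^bsub>G\<^esub> a' = \<one>\<^bsub>G\<^esub> \<longleftrightarrow> a = a'"
      using a a' by (metis G.inv_closed G.inv_inv G.inv_equality G.r_inv)
    then show ?thesis using a a' by (simp add: U_one)
  qed
  finally show ?thesis .
qed

end

lemma complete_system_pair_transformation:
  assumes "complete_system_pair G H I d r s"
  shows "transformation_matrix G H (fourier_change H I d r s)"
proof -
  interpret GH: complete_system_pair G H I d r s by fact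
  interpret HG: complete_system_pair H G I d s r
    using GH.G.complete_system_axioms GH.H.complete_system_axioms by (simp add: complete_system_pair_def)
  \<comment> \<open>Exchanging the groups produces the adjoint matrix, so its row relations are the
    missing column relations.\<close>
  have UV: "HG.U x a = cnj (GH.U a x)" if "a \<in> carrier G" "x \<in> carrier H" for a x
  proof -
    have "cnj (GH.U a x) = GH.U (inv\<^bsub>G\<^esub> a) (inv\<^bsub>H\<^esub> x)" using that by (rule GH.U_inv)
    also have "\<dots> = HG.U x a"
      using that unfolding GH.U_def HG.U_def fourier_change_def
      by (subst sum.swap) (simp add: GH.card_eq mult.commute)
    finally show ?thesis by simp
  qed
  show ?thesis
    using GH.U_rows HG.U_rows GH.U_inv GH.U_mult
    by (simp add: transformation_matrix_def unitary_on_def UV flip: GH.U_def)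
qed

section \<open>Equal degrees yield a transformation matrix\<close>

abbreviation class_degree :: "('a, 'm) monoid_scheme \<Rightarrow> ('a \<Rightarrow> complex mat) set \<Rightarrow> nat" where
  "class_degree G C \<equiv> rep_degree G (SOME \<rho>. \<rho> \<in> C)"

context finite_group
begin

lemma class_degree_eq:
  assumes C: "C \<in> irrep_classes G" and \<rho>: "\<rho> \<in> C"
  shows "class_degree G C = rep_degree G \<rho>"
proof -
  have C': "C \<in> irreps G // irrep_rel" using C by (simp add: irrep_classes_def)
  have "(SOME \<rho>. \<rho> \<in> C) \<in> C" using someI[of "\<lambda>\<rho>. \<rho> \<in> C", OF \<rho>] .
  then have "((SOME \<rho>. \<rho> \<in> C), \<rho>) \<in> irrep_rel"
    using quotient_eq_iff[OF equiv_irrep_rel C' C'] \<rho> by blast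
  then show ?thesis using equivalent_representations_degree by blast
qed

lemma equivalent_representations_restrict:
  assumes \<rho>: "representation G n \<rho>"
  shows "equivalent_representations G \<rho> (restrict \<rho> (carrier G))"
proof -
  have "representation G n (restrict \<rho> (carrier G)) = representation G n \<rho>"
    by (rule representation_cong) simp
  then show ?thesis
    using \<rho> left_mult_one_mat[OF rep_carrier[OF \<rho>]] right_mult_one_mat[OF rep_carrier[OF \<rho>]]
    unfolding equivalent_representations_def carrier_GL
    by (intro exI[of _ n] conjI bexI[of _ "1\<^sub>m n"]) (auto intro!: bexI[of _ "1\<^sub>m n"])
qed

lemma restrict_irreps:
  assumes "irreducible_representation G n \<rho>"
  shows "restrict \<rho> (carrier G) \<in> irreps G"
  using assms irreducible_representation_cong[of "restrict \<rho> (carrier G)" \<rho> n] by (auto simp: irreps_def)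

text \<open>The coefficients of a conjugate of \<open>\<sigma>\<close> are linear combinations,
  independent of \<open>g\<close>, of those of \<open>\<sigma>\<close>.\<close>

lemma annihilates_equivalent:
  assumes eq: "equivalent_representations G \<sigma> \<tau>" and \<sigma>: "representation G n \<sigma>" and ann: "annihilates f n \<sigma>"
  shows "annihilates f n \<tau>"
proof -
  obtain m P Q where m: "representation G m \<sigma>" and \<tau>: "representation G m \<tau>"
    and P: "P \<in> carrier_mat m m" and Q: "Q \<in> carrier_mat m m" and PQ: "P * Q = 1\<^sub>m m"
    and int: "\<forall>g\<in>carrier G. P * \<sigma> g = \<tau> g * P"
    using eq by (auto simp: equivalent_representations_def carrier_GL)
  have mn: "m = n" using rep_degree_eq[OF m] rep_degree_eq[OF \<sigma>] by simp
  show ?thesis unfolding annihilates_def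
  proof (intro allI impI)
    fix i j assume ij: "i < n" "j < n"
    have entry: "\<tau> g $$ (i,j) = (\<Sum>l<m. \<Sum>k<m. P $$ (i,k) * Q $$ (l,j) * \<sigma> g $$ (k,l))" if g: "g \<in> carrier G" for g
    proof -
      note c = rep_carrier[OF m g] rep_carrier[OF \<tau> g]
      have "\<tau> g = (\<tau> g * P) * Q" using assoc_mult_mat[OF c(2) P Q] PQ c by simp
      also have "\<dots> = (P * \<sigma> g) * Q" using int g by simp
      finally have "\<tau> g $$ (i,j) = ((P * \<sigma> g) * Q) $$ (i,j)" by simp
      also have "\<dots> = (\<Sum>l<m. (P * \<sigma> g) $$ (i,l) * Q $$ (l,j))"
        using ij mn by (intro index_mult_mat_sum[OF mult_carrier_mat[OF P c(1)] Q]) auto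
      also have "\<dots> = (\<Sum>l<m. \<Sum>k<m. P $$ (i,k) * Q $$ (l,j) * \<sigma> g $$ (k,l))"
        using ij mn by (simp add: index_mult_mat_sum[OF P c(1)] sum_distrib_left sum_distrib_right mult_ac)
      finally show ?thesis .
    qed
    have "(\<Sum>g\<in>carrier G. f g * \<tau> g $$ (i,j))
        = (\<Sum>g\<in>carrier G. \<Sum>l<m. \<Sum>k<m. P $$ (i,k) * Q $$ (l,j) * (f g * \<sigma> g $$ (k,l)))"
      by (simp add: entry sum_distrib_left mult_ac)
    also have "\<dots> = (\<Sum>l<m. \<Sum>k<m. P $$ (i,k) * Q $$ (l,j) * (\<Sum>g\<in>carrier G. f g * \<sigma> g $$ (k,l)))"
      unfolding sum_distrib_left sum.swap[of _ "{..<m}" "carrier G"] ..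
    also have "\<dots> = 0" using ann mn by (simp add: annihilates_def)
    finally show "(\<Sum>g\<in>carrier G. f g * \<tau> g $$ (i,j)) = 0" .
  qed
qed

lemma irrep_class_unitary:
  assumes C: "C \<in> irrep_classes G"
  shows "\<exists>\<tau>\<in>C. irreducible_representation G (class_degree G C) \<tau> \<and> unitary_representation (class_degree G C) \<tau>"
proof -
  obtain \<rho> n where \<rho>: "\<rho> \<in> irreps G" "C = irrep_rel `` {\<rho>}" "irreducible_representation G n \<rho>"
    using C by (auto simp: irrep_classes_def irreps_def elim!: quotientE)
  obtain \<tau> where \<tau>: "irreducible_representation G n \<tau>" "unitary_representation n \<tau>"
    "equivalent_representations G \<rho> \<tau>"
    using irrep_equivalent_unitary[OF \<rho>(3)] .
  \<comment> \<open>Classes contain extensional maps only, so the unitary representation must be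
    restricted to be a member of \<open>C\<close>.\<close>
  define \<tau>' where "\<tau>' = restrict \<tau> (carrier G)"
  have same: "\<tau>' g = \<tau> g" if "g \<in> carrier G" for g using that by (simp add: \<tau>'_def)
  have irr: "irreducible_representation G n \<tau>'"
    using \<tau>(1) irreducible_representation_cong[OF same] by simp
  have rep: "representation G n \<tau>" "representation G n \<tau>'"
    using \<tau>(1) irr by (auto simp: irreducible_representation_def)
  have "unitary_representation n \<tau>'"
    using \<tau>(2) rep by (auto simp: unitary_representation_def same)
  moreover have "\<tau>' \<in> C"
    using \<rho>(1,2) restrict_irreps[OF \<tau>(1)]
      equivalent_representations_trans[OF \<tau>(3) equivalent_representations_restrict[OF rep(1)]]
    by (auto simp: \<tau>'_def)
  moreover have "class_degree G C = n"
    using class_degree_eq[OF C \<open>\<tau>' \<in> C\<close>] rep_degree_eq[OF rep(2)] by simp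
  ultimately show ?thesis using irr by auto
qed

text \<open>The classes themselves serve as indices. Distinct classes have inequivalent members,
  which gives orthogonality; separation holds because every irreducible representation is equivalent
  to a chosen one, with the same annihilated functions.\<close>

lemma irreps_complete_system:
  obtains u where "complete_system G (irrep_classes G) (class_degree G) (\<lambda>C g p q. u C g $$ (p,q))"
proof -
  obtain u where u: "\<And>C. C \<in> irrep_classes G \<Longrightarrow> u C \<in> C \<and>
      irreducible_representation G (class_degree G C) (u C) \<and> unitary_representation (class_degree G C) (u C)"
    using irrep_class_unitary by metis
  have rep: "representation G (class_degree G C) (u C)" and pos: "class_degree G C > 0"
    if "C \<in> irrep_classes G" for C
    using u[OF that] by (auto simp: irreducible_representation_def)
  have star: "u C (inv g) $$ (p,q) = cnj (u C g $$ (q,p))"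
    if "C \<in> irrep_classes G" "p < class_degree G C" "q < class_degree G C" "g \<in> carrier G" for C p q g
  proof -
    have "u C (inv g) = ctranspose (u C g)"
      using u[OF that(1)] that(4) by (simp add: unitary_representation_def)
    then show ?thesis using rep_carrier[OF rep[OF that(1)] that(4)] that(2,3) by simp
  qed
  have neq: "C = D" if CD: "C \<in> irrep_classes G" "D \<in> irrep_classes G"
    and eq: "equivalent_representations G (u D) (u C)" for C D
  proof -
    have C: "C \<in> irreps G // irrep_rel" and D: "D \<in> irreps G // irrep_rel"
      using CD by (auto simp: irrep_classes_def)
    have "u C \<in> irreps G" "u D \<in> irreps G"
      using u CD in_quotient_imp_subset[OF equiv_irrep_rel C] in_quotient_imp_subset[OF equiv_irrep_rel D] by auto
    then have "(u D, u C) \<in> irrep_rel" using eq by auto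
    then show ?thesis using quotient_eq_iff[OF equiv_irrep_rel D C] u CD by blast
  qed
  have orth: "(\<Sum>g\<in>carrier G. u C g $$ (p,q) * u D (inv g) $$ (k,l))
      = (if C = D \<and> p = l \<and> q = k then N / of_nat (class_degree G C) else 0)"
    if CD: "C \<in> irrep_classes G" "D \<in> irrep_classes G"
      and pq: "p < class_degree G C" "q < class_degree G C" "k < class_degree G D" "l < class_degree G D"
    for C D p q k l
  proof (cases "C = D")
    case True
    then show ?thesis using schur_orthogonality_same[of "class_degree G C" "u C" p q k l] u CD pq by auto
  next
    case False
    have "\<not> equivalent_representations G (u D) (u C)" using neq[OF CD] False by blast
    then show ?thesis
      using schur_orthogonality_inequivalent[of "class_degree G C" "u C" "class_degree G D" "u D" p q k l] u CD pq False
      by simp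
  qed
  have "complete_system G (irrep_classes G) (class_degree G) (\<lambda>C g p q. u C g $$ (p,q))"
  proof
    show "finite (irrep_classes G)"
    \<comment> \<open>Degrees are positive, so every class has an entry \<open>(0,0)\<close>; one
      such coefficient per class is the orthogonal family.\<close>
    proof (rule finite_orthogonal_family[where e = "\<lambda>C g. u C g $$ (0,0)" and d = "class_degree G"])
      fix C D assume "C \<in> irrep_classes G" "D \<in> irrep_classes G"
      then show "(\<Sum>g\<in>carrier G. u C g $$ (0,0) * u D (inv g) $$ (0,0))
          = (if C = D then N / of_nat (class_degree G C) else 0)"
        using orth[of C D 0 0 0 0] pos by simp
    qed (use pos in \<open>auto simp: rep_one[OF rep] star\<close>)
    show "f g = 0" if ann: "\<And>C p q. C \<in> irrep_classes G \<Longrightarrow> p < class_degree G C \<Longrightarrow> q < class_degree G C \<Longrightarrow>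
        (\<Sum>g\<in>carrier G. f g * u C g $$ (p,q)) = 0" and g: "g \<in> carrier G" for f g
    proof (rule unitary_irreps_separate[OF _ g])
      fix m \<tau> assume \<tau>: "irreducible_representation G m \<tau>"
      define \<tau>' where "\<tau>' = restrict \<tau> (carrier G)"
      have m: "representation G m \<tau>" using \<tau> by (simp add: irreducible_representation_def)
      note \<tau>'irr = restrict_irreps[OF \<tau>, folded \<tau>'_def]
        and \<tau>'eq = equivalent_representations_restrict[OF m, folded \<tau>'_def]
      define C where "C = irrep_rel `` {\<tau>'}"
      have C: "C \<in> irrep_classes G" unfolding irrep_classes_def C_def using \<tau>'irr by (rule quotientI)
      then have "(\<tau>', u C) \<in> irrep_rel" using u[of C] unfolding C_def by blast
      then have eq: "equivalent_representations G (u C) \<tau>"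
        using equivalent_representations_sym equivalent_representations_trans[OF \<tau>'eq] by blast
      then have "class_degree G C = m"
        using equivalent_representations_degree[OF eq] rep_degree_eq[OF m] rep_degree_eq[OF rep[OF C]] by simp
      then show "annihilates f m \<tau>"
        using annihilates_equivalent[OF eq] rep[OF C] ann[OF C] by (auto simp: annihilates_def)
    qed
    show "(\<Sum>g\<in>carrier G. u C g $$ (p,q) * u D (inv g) $$ (k,l))
        = (if C = D \<and> p = l \<and> q = k then N / of_nat (class_degree G C) else 0)"
      if "C \<in> irrep_classes G" "D \<in> irrep_classes G" "p < class_degree G C" "q < class_degree G C"
        "k < class_degree G D" "l < class_degree G D" for C D p q k l
      using that by (rule orth)
  qed (use pos in \<open>auto simp: rep_one[OF rep] rep_mult_index[OF rep] star\<close>)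
  then show ?thesis by (rule that)
qed

end

lemma complete_system_reindex:
  fixes G (structure)
  assumes sys: "complete_system G J d r" and b: "bij_betw \<beta> I J" and d: "\<And>i. i \<in> I \<Longrightarrow> d' i = d (\<beta> i)"
  shows "complete_system G I d' (\<lambda>i. r (\<beta> i))"
proof -
  interpret complete_system G J d r by fact
  have \<beta>: "\<beta> i \<in> J" if "i \<in> I" for i using b that by (auto simp: bij_betw_def)
  have inj: "\<beta> i = \<beta> j \<longleftrightarrow> i = j" if "i \<in> I" "j \<in> I" for i j using b that by (auto simp: bij_betw_def inj_on_def)
  show ?thesis
  proof
    show "finite I" using bij_betw_finite[OF b] finite_index by simp
    show "f g = 0" if ann: "\<And>i p q. i \<in> I \<Longrightarrow> p < d' i \<Longrightarrow> q < d' i \<Longrightarrow> (\<Sum>g\<in>carrier G. f g * r (\<beta> i) g p q) = 0"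
      and g: "g \<in> carrier G" for f g
    proof (rule coeff_separate[OF _ g])
      fix j p q assume j: "j \<in> J" "p < d j" "q < d j"
      then obtain i where "i \<in> I" "j = \<beta> i" using b by (auto simp: bij_betw_def)
      then show "(\<Sum>g\<in>carrier G. f g * r j g p q) = 0" using ann d j by simp
    qed
    show "(\<Sum>g\<in>carrier G. r (\<beta> i) g p q * r (\<beta> j) (inv g) k l)
        = (if i = j \<and> p = l \<and> q = k then N / of_nat (d' i) else 0)"
      if "i \<in> I" "j \<in> I" "p < d' i" "q < d' i" "k < d' j" "l < d' j" for i j p q k l
      using that coeff_orthogonal[of "\<beta> i" "\<beta> j" p q k l] \<beta> d inj by simp
  qed (use \<beta> d in \<open>auto simp: degree_pos coeff_one coeff_mult coeff_inv\<close>)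
qed

text \<open>Equal sizes give some bijection, which a permutation of \<open>A\<close> then corrects
  so that the values match.\<close>

lemma image_mset_eq_imp_bij_betw:
  assumes A: "finite A" and B: "finite B" and eq: "image_mset f (mset_set A) = image_mset g (mset_set B)"
  obtains h where "bij_betw h A B" "\<And>x. x \<in> A \<Longrightarrow> f x = g (h x)"
proof -
  have "card A = card B" using arg_cong[OF eq, of size] by simp
  then obtain k where k: "bij_betw k A B" using finite_same_card_bij[OF A B] by blast
  then have "mset_set B = image_mset k (mset_set A)" by (simp add: image_mset_mset_set bij_betw_def)
  then have "image_mset f (mset_set A) = image_mset (g \<circ> k) (mset_set A)"
    using eq by (simp add: image_mset.compositionality)
  then obtain p where p: "p permutes A" "\<forall>x\<in>A. f x = (g \<circ> k) (p x)"
    by (rule image_mset_eq_implies_permutes[OF A])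
  show ?thesis
  proof (rule that)
    show "bij_betw (k \<circ> p) A B" using bij_betw_trans[OF permutes_imp_bij[OF p(1)] k] .
  qed (use p(2) in simp)
qed

lemma transformation_matrix_exists:
  assumes "finite_group G" "finite_group H" and eq: "irrep_degrees G = irrep_degrees H"
  shows "\<exists>U. transformation_matrix G H U"
proof -
  interpret G: finite_group G by fact
  interpret H: finite_group H by fact
  obtain u where u: "complete_system G (irrep_classes G) (class_degree G) (\<lambda>C g p q. u C g $$ (p,q))"
    by (rule G.irreps_complete_system)
  obtain v where v: "complete_system H (irrep_classes H) (class_degree H) (\<lambda>C g p q. v C g $$ (p,q))"
    by (rule H.irreps_complete_system)
  obtain \<beta> where \<beta>: "bij_betw \<beta> (irrep_classes G) (irrep_classes H)"
    "\<And>C. C \<in> irrep_classes G \<Longrightarrow> class_degree G C = class_degree H (\<beta> C)"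
    using image_mset_eq_imp_bij_betw[OF complete_system.finite_index[OF u] complete_system.finite_index[OF v]]
      eq unfolding irrep_degrees_def by blast
  have "complete_system_pair G H (irrep_classes G) (class_degree G)
      (\<lambda>C g p q. u C g $$ (p,q)) (\<lambda>C g p q. v (\<beta> C) g $$ (p,q))"
    using u complete_system_reindex[OF v \<beta>] by (simp add: complete_system_pair_def)
  then show ?thesis using complete_system_pair_transformation by blast
qed

section \<open>A transformation matrix preserves the degrees\<close>

locale transformation = G: finite_group G + H: finite_group H
  for G :: "('a, 'm) monoid_scheme" and H :: "('b, 'n) monoid_scheme" +
  fixes U :: "'a \<Rightarrow> 'b \<Rightarrow> complex"
  assumes transf: "transformation_matrix G H U"
begin

lemma U_rows: "a \<in> carrier G \<Longrightarrow> a' \<in> carrier G \<Longrightarrow>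
    (\<Sum>x\<in>carrier H. U a x * cnj (U a' x)) = (if a = a' then 1 else 0)"
  using transf unfolding transformation_matrix_def unitary_on_def by blast

lemma U_cols: "x \<in> carrier H \<Longrightarrow> y \<in> carrier H \<Longrightarrow>
    (\<Sum>a\<in>carrier G. cnj (U a x) * U a y) = (if x = y then 1 else 0)"
  using transf unfolding transformation_matrix_def unitary_on_def by blast

lemma U_inv: "a \<in> carrier G \<Longrightarrow> x \<in> carrier H \<Longrightarrow> cnj (U a x) = U (inv\<^bsub>G\<^esub> a) (inv\<^bsub>H\<^esub> x)"
  using transf unfolding transformation_matrix_def by blast

lemma U_mult: "a \<in> carrier G \<Longrightarrow> b \<in> carrier G \<Longrightarrow> c \<in> carrier H \<Longrightarrow>
    U (a \<otimes>\<^bsub>G\<^esub> b) c = (\<Sum>(x, y) | x \<in> carrier H \<and> y \<in> carrier H \<and> x \<otimes>\<^bsub>H\<^esub> y = c. U a x * U b y)"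
  using transf unfolding transformation_matrix_def by blast

lemma U_mult_sum:
  "a \<in> carrier G \<Longrightarrow> b \<in> carrier G \<Longrightarrow>
    (\<Sum>c\<in>carrier H. U (a \<otimes>\<^bsub>G\<^esub> b) c * h c) = (\<Sum>x\<in>carrier H. \<Sum>y\<in>carrier H. U a x * U b y * h (x \<otimes>\<^bsub>H\<^esub> y))"
  by (simp add: U_mult H.sum_convolution)

text \<open>The image of \<open>\<one>\<close> is a left unit on the image of the whole group algebra, hence it is the unit.\<close>

lemma U_one:
  assumes c: "c \<in> carrier H"
  shows "U \<one>\<^bsub>G\<^esub> c = (if c = \<one>\<^bsub>H\<^esub> then 1 else 0)"
proof -
  \<comment> \<open>Column orthogonality writes the unit of the group algebra of \<open>H\<close> as
    the image of the element with coefficients \<open>cnj (U b 1)\<close>.\<close>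
  have "(if c = \<one>\<^bsub>H\<^esub> then 1 else 0) = (\<Sum>b\<in>carrier G. cnj (U b \<one>\<^bsub>H\<^esub>) * U (\<one>\<^bsub>G\<^esub> \<otimes>\<^bsub>G\<^esub> b) c)"
    using c U_cols[of "\<one>\<^bsub>H\<^esub>" c] by auto
  also have "\<dots> = (\<Sum>b\<in>carrier G. \<Sum>x\<in>carrier H. cnj (U b \<one>\<^bsub>H\<^esub>) * (U \<one>\<^bsub>G\<^esub> x * U b (inv\<^bsub>H\<^esub> x \<otimes>\<^bsub>H\<^esub> c)))"
    using c by (intro sum.cong refl) (simp only: U_mult G.one_closed H.sum_factorizations sum_distrib_left)
  also have "\<dots> = (\<Sum>x\<in>carrier H. U \<one>\<^bsub>G\<^esub> x * (\<Sum>b\<in>carrier G. cnj (U b \<one>\<^bsub>H\<^esub>) * U b (inv\<^bsub>H\<^esub> x \<otimes>\<^bsub>H\<^esub> c)))"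
    by (subst sum.swap) (simp add: sum_distrib_left mult_ac)
  also have "\<dots> = (\<Sum>x\<in>carrier H. if x = c then U \<one>\<^bsub>G\<^esub> c else 0)"
  proof (rule sum.cong[OF refl])
    fix x assume x: "x \<in> carrier H"
    have "\<one>\<^bsub>H\<^esub> = inv\<^bsub>H\<^esub> x \<otimes>\<^bsub>H\<^esub> c \<longleftrightarrow> x = c"
      using x c by (metis H.inv_closed H.inv_inv H.inv_equality H.l_inv)
    then show "U \<one>\<^bsub>G\<^esub> x * (\<Sum>b\<in>carrier G. cnj (U b \<one>\<^bsub>H\<^esub>) * U b (inv\<^bsub>H\<^esub> x \<otimes>\<^bsub>H\<^esub> c)) = (if x = c then U \<one>\<^bsub>G\<^esub> c else 0)"
      using x c by (simp add: U_cols)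
  qed
  also have "\<dots> = U \<one>\<^bsub>G\<^esub> c" using c H.fin by simp
  finally show ?thesis by simp
qed

text \<open>The inverse of a multiplicative bijection is multiplicative: \<open>U\<close> maps the
  convolution of the rows of \<open>x\<close> and \<open>y\<close> in \<open>V\<close> to the Dirac
  function at their product, and applying \<open>V\<close> returns to the claim.\<close>

lemma adjoint_transformation: "transformation H G (\<lambda>x a. cnj (U a x))"
proof
  define V where "V x a = cnj (U a x)" for x a
  have "V (x \<otimes>\<^bsub>H\<^esub> y) c = (\<Sum>(a, b) | a \<in> carrier G \<and> b \<in> carrier G \<and> a \<otimes>\<^bsub>G\<^esub> b = c. V x a * V y b)" (is "_ = ?F c")
    if x: "x \<in> carrier H" and y: "y \<in> carrier H" and c: "c \<in> carrier G" for x y c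
  proof -
    have transform: "(\<Sum>c\<in>carrier G. ?F c * U c z) = (if x \<otimes>\<^bsub>H\<^esub> y = z then 1 else 0)"
      if z: "z \<in> carrier H" for z
    proof -
      have "(\<Sum>c\<in>carrier G. ?F c * U c z) = (\<Sum>a\<in>carrier G. \<Sum>b\<in>carrier G. V x a * V y b * U (a \<otimes>\<^bsub>G\<^esub> b) z)"
        by (rule G.sum_convolution)
      also have "\<dots> = (\<Sum>a\<in>carrier G. \<Sum>b\<in>carrier G. \<Sum>w\<in>carrier H.
          (V x a * U a w) * (V y b * U b (inv\<^bsub>H\<^esub> w \<otimes>\<^bsub>H\<^esub> z)))"
        using z by (intro sum.cong refl) (simp add: U_mult H.sum_factorizations sum_distrib_left mult_ac)
      also have "\<dots> = (\<Sum>w\<in>carrier H. (\<Sum>a\<in>carrier G. V x a * U a w) * (\<Sum>b\<in>carrier G. V y b * U b (inv\<^bsub>H\<^esub> w \<otimes>\<^bsub>H\<^esub> z)))"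
        unfolding sum_product sum.swap[of _ "carrier G" "carrier H"] ..
      also have "\<dots> = (\<Sum>w\<in>carrier H. if w = x then if y = inv\<^bsub>H\<^esub> x \<otimes>\<^bsub>H\<^esub> z then 1 else 0 else 0)"
        using x y z by (intro sum.cong refl) (auto simp: V_def U_cols)
      also have "\<dots> = (if y = inv\<^bsub>H\<^esub> x \<otimes>\<^bsub>H\<^esub> z then 1 else 0)" using x H.fin by simp
      also have "y = inv\<^bsub>H\<^esub> x \<otimes>\<^bsub>H\<^esub> z \<longleftrightarrow> x \<otimes>\<^bsub>H\<^esub> y = z"
        using x y z by (metis H.inv_solve_left)
      finally show ?thesis .
    qed
    have "?F c = (\<Sum>c'\<in>carrier G. if c' = c then ?F c' else 0)" using c G.fin by simp
    \<comment> \<open>The Dirac function at \<open>c\<close> is expanded by row orthogonality, which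
      brings in \<open>U\<close>.\<close>
    also have "\<dots> = (\<Sum>c'\<in>carrier G. ?F c' * (\<Sum>z\<in>carrier H. U c' z * V z c))"
      using c by (intro sum.cong refl) (simp add: V_def U_rows)
    also have "\<dots> = (\<Sum>z\<in>carrier H. (\<Sum>c'\<in>carrier G. ?F c' * U c' z) * V z c)"
      unfolding sum_distrib_left sum_distrib_right by (subst sum.swap) (simp add: mult.assoc)
    also have "\<dots> = (\<Sum>z\<in>carrier H. if z = x \<otimes>\<^bsub>H\<^esub> y then V z c else 0)"
      by (intro sum.cong refl) (auto simp: transform)
    also have "\<dots> = V (x \<otimes>\<^bsub>H\<^esub> y) c" using x y H.fin by simp
    finally show ?thesis by simp
  qed
  then show "transformation_matrix H G (\<lambda>x a. cnj (U a x))"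
    using U_rows U_cols U_inv unfolding transformation_matrix_def unitary_on_def V_def
    by (auto simp: mult.commute)
qed

section \<open>Pulling representations back along the matrix\<close>

text \<open>Reading the size off \<open>\<sigma>\<close> avoids a degree argument, and restriction
  to the group makes the result extensional, as \<open>irreps\<close> demands.\<close>

definition pullback :: "('b \<Rightarrow> complex mat) \<Rightarrow> 'a \<Rightarrow> complex mat" where
  "pullback \<sigma> = (\<lambda>a\<in>carrier G. mat (rep_degree H \<sigma>) (rep_degree H \<sigma>)
     (\<lambda>(i,j). \<Sum>x\<in>carrier H. U a x * \<sigma> x $$ (i,j)))"

lemma pullback_extensional: "pullback \<sigma> \<in> extensional (carrier G)"
  by (simp add: pullback_def)

context
  fixes n \<sigma> assumes \<sigma>: "representation H n \<sigma>"
begin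

lemma pullback_carrier: "a \<in> carrier G \<Longrightarrow> pullback \<sigma> a \<in> carrier_mat n n"
  by (simp add: pullback_def H.rep_degree_eq[OF \<sigma>])

lemma pullback_index:
  "a \<in> carrier G \<Longrightarrow> i < n \<Longrightarrow> j < n \<Longrightarrow> pullback \<sigma> a $$ (i,j) = (\<Sum>x\<in>carrier H. U a x * \<sigma> x $$ (i,j))"
  by (simp add: pullback_def H.rep_degree_eq[OF \<sigma>])

lemma pullback_mult_vec:
  assumes a: "a \<in> carrier G" and w: "w \<in> carrier_vec n"
  shows "pullback \<sigma> a *\<^sub>v w = vec n (\<lambda>i. \<Sum>x\<in>carrier H. U a x * (\<sigma> x *\<^sub>v w) $ i)"
proof
  fix i assume "i < dim_vec (vec n (\<lambda>i. \<Sum>x\<in>carrier H. U a x * (\<sigma> x *\<^sub>v w) $ i))"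
  then have i: "i < n" by simp
  have "(pullback \<sigma> a *\<^sub>v w) $ i = (\<Sum>l<n. \<Sum>x\<in>carrier H. U a x * (\<sigma> x $$ (i,l) * w $ l))"
    using i a by (simp add: index_mult_mat_vec_sum[OF pullback_carrier w] pullback_index sum_distrib_right mult.assoc)
  also have "\<dots> = (\<Sum>x\<in>carrier H. U a x * (\<sigma> x *\<^sub>v w) $ i)"
    using i by (subst sum.swap)
      (simp add: index_mult_mat_vec_sum[OF H.rep_carrier[OF \<sigma>] w] sum_distrib_left)
  finally show "(pullback \<sigma> a *\<^sub>v w) $ i = vec n (\<lambda>i. \<Sum>x\<in>carrier H. U a x * (\<sigma> x *\<^sub>v w) $ i) $ i"
    using i by simp
qed (use pullback_carrier[OF a] in auto)

lemma pullback_representation: "representation G n (pullback \<sigma>)"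
  unfolding G.representation_iff
proof (intro conjI ballI)
  show "pullback \<sigma> \<one>\<^bsub>G\<^esub> = 1\<^sub>m n"
  proof (rule eq_matI)
    fix i j assume "i < dim_row (1\<^sub>m n :: complex mat)" "j < dim_col (1\<^sub>m n :: complex mat)"
    then have ij: "i < n" "j < n" by auto
    have "pullback \<sigma> \<one>\<^bsub>G\<^esub> $$ (i,j) = (\<Sum>x\<in>carrier H. if x = \<one>\<^bsub>H\<^esub> then \<sigma> \<one>\<^bsub>H\<^esub> $$ (i,j) else 0)"
      using ij by (auto simp: pullback_index U_one intro!: sum.cong)
    then show "pullback \<sigma> \<one>\<^bsub>G\<^esub> $$ (i,j) = 1\<^sub>m n $$ (i,j)"
      using ij H.fin by (simp add: H.rep_one[OF \<sigma>])
  qed (use pullback_carrier[of "\<one>\<^bsub>G\<^esub>"] in auto)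
  fix a assume a: "a \<in> carrier G"
  show ac: "pullback \<sigma> a \<in> carrier_mat n n" by (rule pullback_carrier[OF a])
  fix b assume b: "b \<in> carrier G"
  note bc = pullback_carrier[OF b]
  show "pullback \<sigma> (a \<otimes>\<^bsub>G\<^esub> b) = pullback \<sigma> a * pullback \<sigma> b"
  proof (rule eq_matI)
    fix i j assume "i < dim_row (pullback \<sigma> a * pullback \<sigma> b)" "j < dim_col (pullback \<sigma> a * pullback \<sigma> b)"
    then have ij: "i < n" "j < n" using ac bc by auto
    have "pullback \<sigma> (a \<otimes>\<^bsub>G\<^esub> b) $$ (i,j)
        = (\<Sum>x\<in>carrier H. \<Sum>y\<in>carrier H. U a x * U b y * \<sigma> (x \<otimes>\<^bsub>H\<^esub> y) $$ (i,j))"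
      using a b ij by (simp add: pullback_index U_mult_sum)
    also have "\<dots> = (\<Sum>x\<in>carrier H. \<Sum>y\<in>carrier H. \<Sum>k<n. (U a x * \<sigma> x $$ (i,k)) * (U b y * \<sigma> y $$ (k,j)))"
      using ij by (simp add: H.rep_mult_index[OF \<sigma>] sum_distrib_left mult_ac)
    also have "\<dots> = (\<Sum>k<n. (\<Sum>x\<in>carrier H. U a x * \<sigma> x $$ (i,k)) * (\<Sum>y\<in>carrier H. U b y * \<sigma> y $$ (k,j)))"
      unfolding sum_product sum.swap[of _ "carrier H" "{..<n}"] ..
    also have "\<dots> = (pullback \<sigma> a * pullback \<sigma> b) $$ (i,j)"
      unfolding index_mult_mat_sum[OF ac bc ij] using a b ij by (simp add: pullback_index)
    finally show "pullback \<sigma> (a \<otimes>\<^bsub>G\<^esub> b) $$ (i,j) = (pullback \<sigma> a * pullback \<sigma> b) $$ (i,j)" .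
  qed (use ac bc pullback_carrier[of "a \<otimes>\<^bsub>G\<^esub> b"] a b in auto)
qed

text \<open>Each \<open>pullback \<sigma> a *\<^sub>v w\<close> is a linear combination of the
  vectors \<open>\<sigma> x *\<^sub>v w\<close>.\<close>

lemma pullback_invariant_subspace:
  assumes W: "invariant_subspace H n \<sigma> W"
  shows "invariant_subspace G n (pullback \<sigma>) W"
proof -
  have sub: "VectorSpace.subspace class_ring W (module_vec TYPE(complex) n)"
    and inv: "\<And>x w. x \<in> carrier H \<Longrightarrow> w \<in> W \<Longrightarrow> \<sigma> x *\<^sub>v w \<in> W"
    using W by (auto simp: invariant_subspace_def)
  have "pullback \<sigma> a *\<^sub>v w \<in> W" if a: "a \<in> carrier G" and w: "w \<in> W" for a w
  proof -
    have wc: "w \<in> carrier_vec n" using w sub by (auto simp: subspace_module_vec_iff)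
    show ?thesis unfolding pullback_mult_vec[OF a wc]
      using H.fin inv w by (intro subspace_lincomb[OF sub]) auto
  qed
  then show ?thesis using sub by (simp add: invariant_subspace_def)
qed

end

text \<open>An intertwiner on the group elements intertwines their linear combinations too, so the
  same \<open>P\<close> works.\<close>

lemma pullback_equivalent:
  assumes "equivalent_representations H \<sigma> \<tau>"
  shows "equivalent_representations G (pullback \<sigma>) (pullback \<tau>)"
proof -
  obtain n P where \<sigma>: "representation H n \<sigma>" and \<tau>: "representation H n \<tau>"
    and P: "P \<in> carrier (GL n)" and int: "\<And>x. x \<in> carrier H \<Longrightarrow> P * \<sigma> x = \<tau> x * P"
    using assms by (auto simp: equivalent_representations_def)
  have Pc: "P \<in> carrier_mat n n" using P by (simp add: carrier_GL)
  have "P * pullback \<sigma> a = pullback \<tau> a * P" if a: "a \<in> carrier G" for a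
  proof (rule eq_matI)
    note c = pullback_carrier[OF \<sigma> a] pullback_carrier[OF \<tau> a]
    fix i j assume "i < dim_row (pullback \<tau> a * P)" "j < dim_col (pullback \<tau> a * P)"
    then have ij: "i < n" "j < n" using c Pc by auto
    have "(P * pullback \<sigma> a) $$ (i,j) = (\<Sum>k<n. \<Sum>x\<in>carrier H. U a x * (P $$ (i,k) * \<sigma> x $$ (k,j)))"
      unfolding index_mult_mat_sum[OF Pc c(1) ij] using a ij
      by (simp add: pullback_index[OF \<sigma>] sum_distrib_left mult_ac)
    also have "\<dots> = (\<Sum>x\<in>carrier H. U a x * (P * \<sigma> x) $$ (i,j))"
      using ij by (subst sum.swap) (simp add: index_mult_mat_sum[OF Pc H.rep_carrier[OF \<sigma>]] sum_distrib_left)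
    also have "\<dots> = (\<Sum>x\<in>carrier H. U a x * (\<tau> x * P) $$ (i,j))" by (simp add: int)
    also have "\<dots> = (\<Sum>k<n. \<Sum>x\<in>carrier H. U a x * (\<tau> x $$ (i,k) * P $$ (k,j)))"
      using ij by (subst sum.swap) (simp add: index_mult_mat_sum[OF H.rep_carrier[OF \<tau>] Pc] sum_distrib_left)
    also have "\<dots> = (pullback \<tau> a * P) $$ (i,j)"
      unfolding index_mult_mat_sum[OF c(2) Pc ij] using a ij
      by (simp add: pullback_index[OF \<tau>] sum_distrib_left sum_distrib_right mult_ac)
    finally show "(P * pullback \<sigma> a) $$ (i,j) = (pullback \<tau> a * P) $$ (i,j)" .
  qed (use Pc pullback_carrier[OF \<sigma> a] pullback_carrier[OF \<tau> a] in auto)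
  then show ?thesis
    using P pullback_representation[OF \<sigma>] pullback_representation[OF \<tau>]
    unfolding equivalent_representations_def by blast
qed

text \<open>The same construction for the adjoint matrix with the groups exchanged. Its facts become
  available by interpreting the locale for the adjoint in each proof.\<close>

abbreviation copullback where
  "copullback \<equiv> transformation.pullback H G (\<lambda>x a. cnj (U a x))"

lemma copullback_pullback:
  assumes \<sigma>: "representation H n \<sigma>" and x: "x \<in> carrier H"
  shows "copullback (pullback \<sigma>) x = \<sigma> x"
proof (rule eq_matI)
  interpret A: transformation H G "\<lambda>x a. cnj (U a x)" by (rule adjoint_transformation)
  note p = pullback_representation[OF \<sigma>]
  fix i j assume "i < dim_row (\<sigma> x)" "j < dim_col (\<sigma> x)"
  then have ij: "i < n" "j < n" using H.rep_carrier[OF \<sigma> x] by auto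
  have "copullback (pullback \<sigma>) x $$ (i,j) = (\<Sum>a\<in>carrier G. \<Sum>y\<in>carrier H. cnj (U a x) * U a y * \<sigma> y $$ (i,j))"
    using ij x by (simp add: A.pullback_index[OF p] pullback_index[OF \<sigma>] sum_distrib_left mult.assoc)
  also have "\<dots> = (\<Sum>y\<in>carrier H. (\<Sum>a\<in>carrier G. cnj (U a x) * U a y) * \<sigma> y $$ (i,j))"
    by (subst sum.swap) (simp add: sum_distrib_right)
  also have "\<dots> = (\<Sum>y\<in>carrier H. if y = x then \<sigma> x $$ (i,j) else 0)"
    using x by (intro sum.cong refl) (auto simp: U_cols)
  also have "\<dots> = \<sigma> x $$ (i,j)" using x H.fin by simp
  finally show "copullback (pullback \<sigma>) x $$ (i,j) = \<sigma> x $$ (i,j)" .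
next
  interpret A: transformation H G "\<lambda>x a. cnj (U a x)" by (rule adjoint_transformation)
  show "dim_row (copullback (pullback \<sigma>) x) = dim_row (\<sigma> x)" "dim_col (copullback (pullback \<sigma>) x) = dim_col (\<sigma> x)"
    using A.pullback_carrier[OF pullback_representation[OF \<sigma>] x] H.rep_carrier[OF \<sigma> x] by auto
qed

text \<open>A subspace invariant under \<open>pullback \<sigma>\<close> is invariant under the
  copullback of that, which is \<open>\<sigma>\<close> on \<open>H\<close>.\<close>

lemma pullback_irreducible:
  assumes \<sigma>: "irreducible_representation H n \<sigma>"
  shows "irreducible_representation G n (pullback \<sigma>)"
proof -
  interpret A: transformation H G "\<lambda>x a. cnj (U a x)" by (rule adjoint_transformation)
  have rep: "representation H n \<sigma>" using \<sigma> by (simp add: irreducible_representation_def)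
  note p = pullback_representation[OF rep]
  have "invariant_subspace H n \<sigma> W" if "invariant_subspace G n (pullback \<sigma>) W" for W
    using A.pullback_invariant_subspace[OF p that]
      H.invariant_subspace_cong[OF copullback_pullback[OF rep]] by simp
  then show ?thesis using \<sigma> p by (auto simp: irreducible_representation_def)
qed

lemma pullback_irreps: "\<sigma> \<in> irreps H \<Longrightarrow> pullback \<sigma> \<in> irreps G"
  using pullback_irreducible pullback_extensional by (auto simp: irreps_def)

lemma copullback_pullback_irreps:
  assumes "\<sigma> \<in> irreps H"
  shows "copullback (pullback \<sigma>) = \<sigma>"
proof (rule extensionalityI)
  interpret A: transformation H G "\<lambda>x a. cnj (U a x)" by (rule adjoint_transformation)
  show "copullback (pullback \<sigma>) \<in> extensional (carrier H)" by (rule A.pullback_extensional)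
  show "\<sigma> \<in> extensional (carrier H)" using assms by (simp add: irreps_def)
  fix x assume "x \<in> carrier H"
  then show "copullback (pullback \<sigma>) x = \<sigma> x"
    using assms copullback_pullback by (auto simp: irreps_def irreducible_representation_def)
qed

lemma bij_betw_pullback: "bij_betw pullback (irreps H) (irreps G)"
proof -
  interpret A: transformation H G "\<lambda>x a. cnj (U a x)" by (rule adjoint_transformation)
  show ?thesis
  proof (rule bij_betwI[where g = copullback])
    \<comment> \<open>The adjoint of the adjoint is \<open>U\<close>, so this is the preceding lemma
      for the adjoint matrix.\<close>
    show "pullback (copullback \<rho>) = \<rho>" if "\<rho> \<in> irreps G" for \<rho>
      using A.copullback_pullback_irreps[OF that] by simp
  qed (use pullback_irreps A.pullback_irreps copullback_pullback_irreps in auto)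
qed

lemma pullback_equivalent_iff:
  assumes "\<sigma> \<in> irreps H" "\<tau> \<in> irreps H"
  shows "equivalent_representations G (pullback \<sigma>) (pullback \<tau>) \<longleftrightarrow> equivalent_representations H \<sigma> \<tau>"
proof
  interpret A: transformation H G "\<lambda>x a. cnj (U a x)" by (rule adjoint_transformation)
  assume "equivalent_representations G (pullback \<sigma>) (pullback \<tau>)"
  from A.pullback_equivalent[OF this] show "equivalent_representations H \<sigma> \<tau>"
    using assms by (simp add: copullback_pullback_irreps)
qed (rule pullback_equivalent)

end

section \<open>Passage to classes and degrees\<close>

text \<open>\<open>F\<close> maps the class of \<open>a\<close> onto the class of
  \<open>F a\<close>; injectivity on classes is inherited from injectivity on
  \<open>A\<close>.\<close>

lemma bij_betw_quotient:
  assumes F: "bij_betw F A B" and r: "r \<subseteq> A \<times> A" and s: "s \<subseteq> B \<times> B"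
    and iff: "\<And>a b. a \<in> A \<Longrightarrow> b \<in> A \<Longrightarrow> (F a, F b) \<in> s \<longleftrightarrow> (a, b) \<in> r"
  shows "bij_betw ((`) F) (A // r) (B // s)"
proof (rule bij_betw_imageI)
  have "A // r \<subseteq> Pow A" using r by (auto simp: quotient_def)
  then show "inj_on ((`) F) (A // r)"
    using inj_on_image_Pow[of F A] F inj_on_subset by (auto simp: bij_betw_def)
  have cls: "F ` (r `` {a}) = s `` {F a}" if a: "a \<in> A" for a
  proof
    show "F ` (r `` {a}) \<subseteq> s `` {F a}" using iff r a by auto
    show "s `` {F a} \<subseteq> F ` (r `` {a})"
    proof
      fix b assume b: "b \<in> s `` {F a}"
      then obtain a' where "a' \<in> A" "b = F a'" using s F by (auto simp: bij_betw_def)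
      then show "b \<in> F ` (r `` {a})" using b iff a by auto
    qed
  qed
  have B: "B = F ` A" using F by (simp add: bij_betw_def)
  show "(`) F ` (A // r) = B // s"
    unfolding B quotient_def using cls by (auto simp: image_UN)
qed

context transformation
begin

lemma irrep_degrees_eq: "irrep_degrees G = irrep_degrees H"
proof -
  have bij: "bij_betw ((`) pullback) (irrep_classes H) (irrep_classes G)"
    unfolding irrep_classes_def
  proof (rule bij_betw_quotient[OF bij_betw_pullback])
    fix \<sigma> \<tau> assume "\<sigma> \<in> irreps H" "\<tau> \<in> irreps H"
    then show "(pullback \<sigma>, pullback \<tau>) \<in> G.irrep_rel \<longleftrightarrow> (\<sigma>, \<tau>) \<in> H.irrep_rel"
      by (simp add: pullback_irreps pullback_equivalent_iff)
  qed auto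
  have degree: "class_degree G (pullback ` C) = class_degree H C" if C: "C \<in> irrep_classes H" for C
  proof -
    have "C \<in> irreps H // H.irrep_rel" using C by (simp add: irrep_classes_def)
    then have "C \<noteq> {}" "C \<subseteq> irreps H"
      using in_quotient_imp_non_empty[OF H.equiv_irrep_rel] in_quotient_imp_subset[OF H.equiv_irrep_rel]
      by auto
    then obtain \<sigma> where "\<sigma> \<in> C" "\<sigma> \<in> irreps H" by auto
    then obtain n where \<sigma>: "\<sigma> \<in> C" "representation H n \<sigma>"
      by (auto simp: irreps_def irreducible_representation_def)
    have "pullback ` C \<in> irrep_classes G" using bij C by (auto simp: bij_betw_def)
    \<comment> \<open>Any member determines the degree, so the choices made in \<open>C\<close> and
      in its image need not correspond under \<open>pullback\<close>.\<close>
    then have "class_degree G (pullback ` C) = rep_degree G (pullback \<sigma>)"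
      using \<sigma>(1) by (intro G.class_degree_eq) auto
    also have "\<dots> = rep_degree H \<sigma>"
      using G.rep_degree_eq[OF pullback_representation[OF \<sigma>(2)]] H.rep_degree_eq[OF \<sigma>(2)] by simp
    also have "\<dots> = class_degree H C" using H.class_degree_eq[OF C \<sigma>(1)] by simp
    finally show ?thesis .
  qed
  have "mset_set (irrep_classes G) = image_mset ((`) pullback) (mset_set (irrep_classes H))"
    using bij by (simp add: image_mset_mset_set bij_betw_def)
  then have "irrep_degrees G = image_mset (\<lambda>C. class_degree G (pullback ` C)) (mset_set (irrep_classes H))"
    by (simp add: irrep_degrees_def image_mset.compositionality comp_def)
  also have "\<dots> = irrep_degrees H"
    unfolding irrep_degrees_def
    \<comment> \<open>For an infinite set of classes \<open>mset_set\<close> would be empty, and so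
      would both sides.\<close>
    by (cases "finite (irrep_classes H)") (auto simp: degree intro!: image_mset_cong)
  finally show ?thesis .
qed

end

theorem corollary7p6:
  fixes G :: "('a, 'm) monoid_scheme" and G' :: "('b, 'n) monoid_scheme"
  assumes "group G" and "finite (carrier G)"
    and "group G'" and "finite (carrier G')"
  shows "(\<exists>U. transformation_matrix G G' U) \<longleftrightarrow> irrep_degrees G = irrep_degrees G'"
proof
  have fin: "finite_group G" "finite_group G'"
    using assms by (auto simp: finite_group_def finite_group_axioms_def)
  assume "\<exists>U. transformation_matrix G G' U"
  then obtain U where "transformation G G' U"
    using fin by (auto simp: transformation_def transformation_axioms_def)
  then show "irrep_degrees G = irrep_degrees G'" by (rule transformation.irrep_degrees_eq)
next
  have "finite_group G" "finite_group G'"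
    using assms by (auto simp: finite_group_def finite_group_axioms_def)
  then show "irrep_degrees G = irrep_degrees G' \<Longrightarrow> \<exists>U. transformation_matrix G G' U"
    by (rule transformation_matrix_exists)
qed

end
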